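(* Let $\mathbb{G}$ be a stratified Lie group of step $s$ with adapted basis $\{X^i_\alpha\}$, structural constants $c(i,j)^\gamma_{\alpha\beta}$ and graded coordinates $x^i_\alpha$. Let $i_0\in\{1,\dots,s-1\}$ and $\beta_0\in\{1,\dots,n_{i_0}\}$. Then $$X^{i_0}_{\beta_0}=\big(X^{i_0}_{\beta_0}\big)^r+\sum_{k=1}^{s-i_0}\frac1{k!}\sum_{\substack{(i_1,\dots,i_k)\in\{1,\dots,s\}^k\\ i_1+\dots+i_k\le s-i_0}}\ \sum_{\substack{(\alpha_1,\dots,\alpha_k)\\ 1\le\alpha_j\le n_{i_j}}}\ \sum_{\substack{(\beta_1,\dots,\beta_k)\\ 1\le\beta_j\le n_{i_0+i_1+\dots+i_j}}}\Big(\prod_{j=1}^k c(i_j,\,i_0+i_1+\dots+i_{j-1})^{\beta_j}_{\alpha_j\beta_{j-1}}\Big)\,x^{i_1}_{\alpha_1}\cdots x^{i_k}_{\alpha_k}\,\big(X^{i_0+i_1+\dots+i_k}_{\beta_k}\big)^r .$$ If instead $i_0=s$, then $X^s_{\beta_0}=\big(X^s_{\beta_0}\big)^r$ for every $\beta_0\in\{1,\dots,n_s\}$.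
   Context: $\mathbb{G}$ is a connected, simply connected Lie group with identity $e$ whose Lie algebra $\mathfrak g$ of left-invariant vector fields has a stratification $\mathfrak g=V_1\oplus\dots\oplus V_s$ with nontrivial $V_i$, $V_{i+1}=[V_1,V_i]$ for $i=1,\dots,s-1$, and $[V_1,V_s]=\{0\}$. Put $n_i=\dim V_i$ and fix a basis $X^i_1,\dots,X^i_{n_i}$ of $V_i$ for each $i$. The exponential map $\exp:\mathfrak g\to\mathbb G$ is a diffeomorphism, and the graded coordinates $x^i_\alpha=x^i_\alpha(p)$ of $p\in\mathbb G$ are defined by $p=\exp\big(\sum_{i=1}^s\sum_{\alpha=1}^{n_i}x^i_\alpha X^i_\alpha\big)$. The structural constants are defined by $[X^i_\alpha,X^j_\beta]=\sum_{\gamma=1}^{n_{i+j}}c(i,j)^\gamma_{\alpha\beta}X^{i+j}_\gamma$ for $i+j\le s$. With $R_p(q)=q\cdot p$ the right translation, the right-invariant vector field corresponding to $X^i_\alpha$ is $(X^i_\alpha)^r(p)=(dR_p)_e(X^i_\alpha(e))$. *)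

theory Defs
  imports "HOL-Analysis.Analysis" "HOL-Library.Function_Algebras" "HOL-Algebra.Group"
begin

section \<open>Smooth manifolds and smooth maps\<close>

text \<open>\<open>Ck_on k S f\<close>: \<open>f\<close> is \<open>k\<close> times continuously differentiable on \<open>S\<close>. It is only used for
  open \<open>S\<close>.\<close>

primrec Ck_on :: "nat \<Rightarrow> 'a::real_normed_vector set \<Rightarrow> ('a \<Rightarrow> 'b::real_normed_vector) \<Rightarrow> bool" where
  "Ck_on 0 S f \<longleftrightarrow> continuous_on S f"
| "Ck_on (Suc k) S f \<longleftrightarrow>
     (\<exists>f'. (\<forall>x\<in>S. (f has_derivative f' x) (at x)) \<and> (\<forall>v. Ck_on k S (\<lambda>x. f' x v)))"

definition smooth_on :: "'a::real_normed_vector set \<Rightarrow> ('a \<Rightarrow> 'b::real_normed_vector) \<Rightarrow> bool" where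
  "smooth_on S f \<longleftrightarrow> (\<forall>k. Ck_on k S f)"

text \<open>A chart is a pair of a domain and a coordinate map; an atlas is a set of charts and need
  not be maximal. The manifold is the whole type \<open>'m\<close>, its dimension is \<open>DIM('e)\<close>.\<close>

type_synonym ('m, 'e) atlas = "('m set \<times> ('m \<Rightarrow> 'e)) set"

definition smooth_atlas ::
  "('m::{t2_space,second_countable_topology}, 'e::euclidean_space) atlas \<Rightarrow> bool" where
  "smooth_atlas A \<longleftrightarrow>
     (\<Union>(U, \<phi>)\<in>A. U) = UNIV \<and>
     (\<forall>(U, \<phi>)\<in>A. open U \<and> open (\<phi> ` U) \<and> homeomorphism U (\<phi> ` U) \<phi> (inv_into U \<phi>)) \<and>
     (\<forall>(U, \<phi>)\<in>A. \<forall>(V, \<psi>)\<in>A. smooth_on (\<phi> ` (U \<inter> V)) (\<psi> \<circ> inv_into U \<phi>))"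

definition std_atlas :: "('e, 'e::euclidean_space) atlas" where
  "std_atlas = {(UNIV, id)}"

definition prod_atlas :: "('m, 'e) atlas \<Rightarrow> ('n, 'f) atlas \<Rightarrow> ('m \<times> 'n, 'e \<times> 'f) atlas" where
  "prod_atlas A B = {(U \<times> V, map_prod \<phi> \<psi>) | U \<phi> V \<psi>. (U, \<phi>) \<in> A \<and> (V, \<psi>) \<in> B}"

definition smooth_map ::
  "('m::topological_space, 'e::euclidean_space) atlas \<Rightarrow>
   ('n::topological_space, 'f::euclidean_space) atlas \<Rightarrow> ('m \<Rightarrow> 'n) \<Rightarrow> bool" where
  "smooth_map A B f \<longleftrightarrow>
     continuous_on UNIV f \<and>
     (\<forall>(U, \<phi>)\<in>A. \<forall>(V, \<psi>)\<in>B. smooth_on (\<phi> ` (U \<inter> f -` V)) (\<psi> \<circ> f \<circ> inv_into U \<phi>))"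

abbreviation smooth_fun ::
  "('m::topological_space, 'e::euclidean_space) atlas \<Rightarrow> ('m \<Rightarrow> real) \<Rightarrow> bool" where
  "smooth_fun A \<equiv> smooth_map A std_atlas"


section \<open>Tangent vectors and vector fields\<close>

text \<open>Tangent vectors at \<open>p\<close> are the derivations at \<open>p\<close> of the algebra of smooth real functions.
  They are normalised to vanish on functions that are not smooth, so that two tangent vectors
  (or vector fields) are equal in HOL iff they agree on smooth functions. The vector space
  operations are the pointwise ones of \<^theory>\<open>HOL-Library.Function_Algebras\<close>.\<close>

type_synonym 'm tvec = "('m \<Rightarrow> real) \<Rightarrow> real"
type_synonym 'm vfield = "'m \<Rightarrow> 'm tvec"

definition tangent_space ::
  "('m::topological_space, 'e::euclidean_space) atlas \<Rightarrow> 'm \<Rightarrow> 'm tvec set" where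
  "tangent_space A p =
     {v. (\<forall>f. \<not> smooth_fun A f \<longrightarrow> v f = 0) \<and>
         (\<forall>f g. smooth_fun A f \<longrightarrow> smooth_fun A g \<longrightarrow>
            v (\<lambda>q. f q + g q) = v f + v g \<and>
            v (\<lambda>q. f q * g q) = f p * v g + g p * v f) \<and>
         (\<forall>c f. smooth_fun A f \<longrightarrow> v (\<lambda>q. c * f q) = c * v f)}"

definition smooth_vfield ::
  "('m::topological_space, 'e::euclidean_space) atlas \<Rightarrow> 'm vfield \<Rightarrow> bool" where
  "smooth_vfield A X \<longleftrightarrow>
     (\<forall>p. X p \<in> tangent_space A p) \<and>
     (\<forall>f. smooth_fun A f \<longrightarrow> smooth_fun A (\<lambda>p. X p f))"

text \<open>The differential of a map \<open>h\<close> of the manifold to itself. The base point does not enter the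
  formula: \<open>differential A h v\<close> is \<open>dh\<^sub>p(v)\<close> for \<open>v\<close> tangent at \<open>p\<close>.\<close>

definition differential ::
  "('m::topological_space, 'e::euclidean_space) atlas \<Rightarrow> ('m \<Rightarrow> 'm) \<Rightarrow> 'm tvec \<Rightarrow> 'm tvec" where
  "differential A h v = (\<lambda>f. if smooth_fun A f then v (f \<circ> h) else 0)"

definition lie_bracket :: "'m vfield \<Rightarrow> 'm vfield \<Rightarrow> 'm vfield" where
  "lie_bracket X Y = (\<lambda>p f. X p (\<lambda>q. Y q f) - Y p (\<lambda>q. X q f))"

definition vf_scale :: "real \<Rightarrow> 'm vfield \<Rightarrow> 'm vfield" (infixr "*\<^sub>v" 75) where
  "c *\<^sub>v X = (\<lambda>p f. c * X p f)"

definition vf_mult :: "('m \<Rightarrow> real) \<Rightarrow> 'm vfield \<Rightarrow> 'm vfield" (infixr "\<cdot>\<^sub>v" 75) where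
  "u \<cdot>\<^sub>v X = (\<lambda>p f. u p * X p f)"

interpretation vf: vector_space "vf_scale :: real \<Rightarrow> 'm vfield \<Rightarrow> 'm vfield"
  by unfold_locales (auto simp: vf_scale_def fun_eq_iff algebra_simps)


section \<open>Lie groups\<close>

definition lie_group ::
  "'g::{t2_space,second_countable_topology} monoid \<Rightarrow> ('g, 'e::euclidean_space) atlas \<Rightarrow> bool" where
  "lie_group G A \<longleftrightarrow>
     group G \<and> carrier G = UNIV \<and> smooth_atlas A \<and>
     smooth_map (prod_atlas A A) A (\<lambda>(p, q). p \<otimes>\<^bsub>G\<^esub> q) \<and>
     smooth_map A A (\<lambda>p. inv\<^bsub>G\<^esub> p)"

definition left_invariant ::
  "'g::topological_space monoid \<Rightarrow> ('g, 'e::euclidean_space) atlas \<Rightarrow> 'g vfield \<Rightarrow> bool" where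
  "left_invariant G A X \<longleftrightarrow> (\<forall>p q. X (p \<otimes>\<^bsub>G\<^esub> q) = differential A (\<lambda>r. p \<otimes>\<^bsub>G\<^esub> r) (X q))"

definition lie_algebra ::
  "'g::topological_space monoid \<Rightarrow> ('g, 'e::euclidean_space) atlas \<Rightarrow> 'g vfield set" where
  "lie_algebra G A = {X. smooth_vfield A X \<and> left_invariant G A X}"

definition right_invariant_vf ::
  "'g::topological_space monoid \<Rightarrow> ('g, 'e::euclidean_space) atlas \<Rightarrow> 'g vfield \<Rightarrow> 'g vfield" where
  "right_invariant_vf G A X = (\<lambda>p. differential A (\<lambda>q. q \<otimes>\<^bsub>G\<^esub> p) (X \<one>\<^bsub>G\<^esub>))"

definition one_parameter_subgroup ::
  "'g::topological_space monoid \<Rightarrow> ('g, 'e::euclidean_space) atlas \<Rightarrow> (real \<Rightarrow> 'g) \<Rightarrow> bool" where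
  "one_parameter_subgroup G A \<gamma> \<longleftrightarrow>
     smooth_map std_atlas A \<gamma> \<and> (\<forall>t u. \<gamma> (t + u) = \<gamma> t \<otimes>\<^bsub>G\<^esub> \<gamma> u)"

text \<open>\<open>lie_exp G A X\<close> is \<open>\<gamma>(1)\<close>, where \<open>\<gamma>\<close> is the one-parameter subgroup with \<open>\<gamma>'(0) = X(e)\<close>. On a
  Lie group such a \<open>\<gamma>\<close> exists and is unique for each left-invariant \<open>X\<close>.\<close>

definition lie_exp ::
  "'g::topological_space monoid \<Rightarrow> ('g, 'e::euclidean_space) atlas \<Rightarrow> 'g vfield \<Rightarrow> 'g" where
  "lie_exp G A X =
     (SOME p. \<exists>\<gamma>. one_parameter_subgroup G A \<gamma> \<and>
        (\<forall>f. smooth_fun A f \<longrightarrow> ((\<lambda>t. f (\<gamma> t)) has_real_derivative X \<one>\<^bsub>G\<^esub> f) (at 0)) \<and>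
        p = \<gamma> 1)"


section \<open>Stratified groups\<close>

text \<open>Only the values \<open>V i\<close> with \<open>1 \<le> i \<le> s\<close> matter. The bracket of two subspaces is the linear
  span of the brackets of their elements.\<close>

definition bracket_space :: "'m vfield set \<Rightarrow> 'm vfield set \<Rightarrow> 'm vfield set" where
  "bracket_space U W = vf.span {lie_bracket Y Z | Y Z. Y \<in> U \<and> Z \<in> W}"

definition stratification :: "'m vfield set \<Rightarrow> nat \<Rightarrow> (nat \<Rightarrow> 'm vfield set) \<Rightarrow> bool" where
  "stratification \<gg> s V \<longleftrightarrow>
     1 \<le> s \<and>
     (\<forall>i\<in>{1..s}. vf.subspace (V i) \<and> V i \<noteq> {0}) \<and>
     \<gg> = {\<Sum>i=1..s. Y i | Y. \<forall>i\<in>{1..s}. Y i \<in> V i} \<and>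
     (\<forall>Y. (\<forall>i\<in>{1..s}. Y i \<in> V i) \<longrightarrow> (\<Sum>i=1..s. Y i) = 0 \<longrightarrow> (\<forall>i\<in>{1..s}. Y i = 0)) \<and>
     (\<forall>i\<in>{1..<s}. V (i + 1) = bracket_space (V 1) (V i)) \<and>
     bracket_space (V 1) (V s) = {0}"

definition stratified_group ::
  "'g::{t2_space,second_countable_topology} monoid \<Rightarrow> ('g, 'e::euclidean_space) atlas \<Rightarrow>
   nat \<Rightarrow> (nat \<Rightarrow> 'g vfield set) \<Rightarrow> bool" where
  "stratified_group G A s V \<longleftrightarrow>
     lie_group G A \<and> connected (UNIV :: 'g set) \<and> simply_connected (UNIV :: 'g set) \<and>
     stratification (lie_algebra G A) s V"

text \<open>\<open>X i \<alpha>\<close> for \<open>1 \<le> \<alpha> \<le> n i\<close> is the basis of \<open>V i\<close>.\<close>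

definition adapted_basis ::
  "nat \<Rightarrow> (nat \<Rightarrow> 'm vfield set) \<Rightarrow> (nat \<Rightarrow> nat) \<Rightarrow> (nat \<Rightarrow> nat \<Rightarrow> 'm vfield) \<Rightarrow> bool" where
  "adapted_basis s V n X \<longleftrightarrow>
     (\<forall>i\<in>{1..s}. n i = vf.dim (V i) \<and> inj_on (X i) {1..n i} \<and>
        vf.independent (X i ` {1..n i}) \<and> vf.span (X i ` {1..n i}) = V i)"

text \<open>\<open>c i j \<alpha> \<beta> \<gamma>\<close> stands for \<open>c(i,j)\<close> with lower indices \<open>\<alpha>, \<beta>\<close> and upper index \<open>\<gamma>\<close>.\<close>

definition structural_constants ::
  "nat \<Rightarrow> (nat \<Rightarrow> nat) \<Rightarrow> (nat \<Rightarrow> nat \<Rightarrow> 'm vfield) \<Rightarrow>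
   (nat \<Rightarrow> nat \<Rightarrow> nat \<Rightarrow> nat \<Rightarrow> nat \<Rightarrow> real) \<Rightarrow> bool" where
  "structural_constants s n X c \<longleftrightarrow>
     (\<forall>i j. 1 \<le> i \<longrightarrow> 1 \<le> j \<longrightarrow> i + j \<le> s \<longrightarrow>
        (\<forall>\<alpha>\<in>{1..n i}. \<forall>\<beta>\<in>{1..n j}.
           lie_bracket (X i \<alpha>) (X j \<beta>) = (\<Sum>\<gamma>=1..n (i + j). c i j \<alpha> \<beta> \<gamma> *\<^sub>v X (i + j) \<gamma>)))"

text \<open>The coordinates of \<open>p\<close> are the unique coefficients whose combination of the basis fields has
  exponential \<open>p\<close>.\<close>

definition graded_coordinates ::
  "'g::topological_space monoid \<Rightarrow> ('g, 'e::euclidean_space) atlas \<Rightarrow>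
   nat \<Rightarrow> (nat \<Rightarrow> nat) \<Rightarrow> (nat \<Rightarrow> nat \<Rightarrow> 'g vfield) \<Rightarrow> (nat \<Rightarrow> nat \<Rightarrow> 'g \<Rightarrow> real) \<Rightarrow> bool" where
  "graded_coordinates G A s n X x \<longleftrightarrow>
     (\<forall>p a. p = lie_exp G A (\<Sum>i=1..s. \<Sum>\<alpha>=1..n i. a i \<alpha> *\<^sub>v X i \<alpha>) \<longleftrightarrow>
        (\<forall>i\<in>{1..s}. \<forall>\<alpha>\<in>{1..n i}. a i \<alpha> = x i \<alpha> p))"

end

theory Submission
  imports Defs
begin

text \<open>
  Fix a point \<open>p = exp Z\<close>, where \<open>Z = \<Sum> x\<^sub>\<alpha>\<^sup>i(p) X\<^sub>\<alpha>\<^sup>i\<close> has the graded coordinates of \<open>p\<close> as coefficients. A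
  left-invariant field \<open>Y\<close> satisfies \<open>Y(p) = dL\<^sub>p Y(e) = dR\<^sub>p (Ad\<^sub>p Y)(e)\<close>, and \<open>Ad\<^sub>p = e\<^bsup>ad Z\<^esup>\<close>. Hence \<open>Y(p)\<close> is the sum over \<open>k\<close>
  of \<open>1/k!\<close> times the right-invariant field of \<open>ad\<^sub>Z\<^sup>k Y\<close> at \<open>p\<close>. The sum is finite because bracketing with \<open>Z\<close> raises the
  degree, and writing \<open>ad\<^sub>Z\<^sup>k Y\<close> for a basis field \<open>Y\<close> in terms of structural constants gives the
  formula.

  The identity \<open>Ad\<^sub>p = e\<^bsup>ad Z\<^esup>\<close> is obtained along the one-parameter subgroup \<open>\<gamma>\<close> of \<open>Z\<close>. By
  \<open>conjugation_derivative\<close>, the derivative of \<open>t \<mapsto> Ad(\<gamma>(t)) Y\<close>, tested against a smooth function, is the same expression for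
  \<open>[Z, Y]\<close>. Evaluating tangent vectors by differentiating along one-parameter subgroups makes this a statement on mixed
  partial derivatives of a smooth function of three real variables. The smoothness of that
  function is the purpose of the first sections: chain rule, pairing and locality for \<open>C\<^sup>k\<close> maps, then
  for maps between manifolds. As \<open>ad\<^sub>Z\<close> is nilpotent, Taylor's formula ends after finitely many terms
  (\<open>left_invariant_eq_exp_ad_right_invariant\<close>).

  One-parameter subgroups exist for all fields of the Lie algebra because the exponential map is
  injective in graded coordinates (\<open>generator_exists\<close>). The Jacobi identity extends the
  stratification condition to brackets of arbitrary layers (\<open>lie_bracket_layer\<close>), and
  \<open>iterated_bracket_expansion\<close> expands \<open>ad\<^sub>Z\<^sup>k Y\<close>.
\<close>

section \<open>Calculus of \<open>C\<^sup>k\<close> functions\<close>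

lemma Ck_on_cong:
  assumes "open S" "\<And>x. x \<in> S \<Longrightarrow> f x = g x" "Ck_on k S f"
  shows "Ck_on k S g"
proof (cases k)
  case 0
  then show ?thesis using assms by (auto cong: continuous_on_cong)
next
  case (Suc m)
  then obtain f' where f': "\<And>x. x \<in> S \<Longrightarrow> (f has_derivative f' x) (at x)"
      "\<And>v. Ck_on m S (\<lambda>x. f' x v)"
    using assms(3) by auto
  have "(g has_derivative f' x) (at x)" if "x \<in> S" for x
    using has_derivative_transform_within_open[OF f'(1)[OF that] assms(1) that] assms(2) by blast
  then show ?thesis using Suc f'(2) by auto
qed

lemma Ck_on_subset: "Ck_on k T f \<Longrightarrow> S \<subseteq> T \<Longrightarrow> Ck_on k S f"
proof (induction k arbitrary: f)
  case 0
  then show ?case by (auto intro: continuous_on_subset)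
next
  case (Suc k)
  then show ?case by (simp, blast)
qed

lemma Ck_on_Suc_imp_Ck_on: "Ck_on (Suc k) S f \<Longrightarrow> Ck_on k S f"
proof (induction k arbitrary: f)
  case 0
  then show ?case
    by (auto intro!: continuous_at_imp_continuous_on dest!: has_derivative_continuous)
next
  case (Suc k)
  then obtain f' where "\<And>x. x \<in> S \<Longrightarrow> (f has_derivative f' x) (at x)"
      "\<And>v. Ck_on (Suc k) S (\<lambda>x. f' x v)"
    by auto
  with Suc.IH show ?case unfolding Ck_on.simps(2)[of _ S f] by blast
qed

lemma Ck_on_const: "Ck_on k S (\<lambda>_. c)"
proof (induction k arbitrary: c)
  case (Suc k)
  then show ?case by (auto intro!: exI[of _ "\<lambda>_ _. 0"])
qed simp

lemma Ck_on_bounded_linear: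
  assumes "bounded_linear L"
  shows "Ck_on k S L"
proof (cases k)
  case 0
  then show ?thesis using assms by (simp add: linear_continuous_on)
next
  case (Suc m)
  then show ?thesis
    using bounded_linear_imp_has_derivative[OF assms] by (auto intro!: exI[of _ "\<lambda>_. L"] Ck_on_const)
qed

lemma Ck_on_bounded_linear_compose:
  assumes "bounded_linear L"
  shows "Ck_on k S f \<Longrightarrow> Ck_on k S (\<lambda>x. L (f x))"
proof (induction k arbitrary: f)
  case 0
  then show ?case
    using bounded_linear.continuous_on[OF assms] by simp
next
  case (Suc k)
  then obtain f' where f': "\<And>x. x \<in> S \<Longrightarrow> (f has_derivative f' x) (at x)"
      "\<And>v. Ck_on k S (\<lambda>x. f' x v)"
    by auto
  have "\<And>x. x \<in> S \<Longrightarrow> ((\<lambda>x. L (f x)) has_derivative (\<lambda>v. L (f' x v))) (at x)"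
    using bounded_linear.has_derivative[OF assms f'(1)] .
  with Suc.IH[OF f'(2)] show ?case by (auto intro!: exI[of _ "\<lambda>x v. L (f' x v)"])
qed

lemma Ck_on_add: "Ck_on k S f \<Longrightarrow> Ck_on k S g \<Longrightarrow> Ck_on k S (\<lambda>x. f x + g x)"
proof (induction k arbitrary: f g)
  case 0
  then show ?case by (simp add: continuous_on_add)
next
  case (Suc k)
  from Suc.prems(1) obtain f' where f': "\<And>x. x \<in> S \<Longrightarrow> (f has_derivative f' x) (at x)"
      "\<And>v. Ck_on k S (\<lambda>x. f' x v)" by auto
  from Suc.prems(2) obtain g' where g': "\<And>x. x \<in> S \<Longrightarrow> (g has_derivative g' x) (at x)"
      "\<And>v. Ck_on k S (\<lambda>x. g' x v)" by auto
  from Suc.IH[OF f'(2) g'(2)] show ?case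
    by (auto intro!: exI[of _ "\<lambda>x v. f' x v + g' x v"] has_derivative_add f'(1) g'(1))
qed

lemma Ck_on_sum: "(\<And>i. i \<in> I \<Longrightarrow> Ck_on k S (f i)) \<Longrightarrow> Ck_on k S (\<lambda>x. \<Sum>i\<in>I. f i x)"
  by (induction I rule: infinite_finite_induct) (auto intro: Ck_on_const Ck_on_add)

lemma Ck_on_scaleR:
  fixes f :: "'a::real_normed_vector \<Rightarrow> real"
  shows "Ck_on k S f \<Longrightarrow> Ck_on k S g \<Longrightarrow> Ck_on k S (\<lambda>x. f x *\<^sub>R g x)"
proof (induction k arbitrary: f g)
  case 0
  then show ?case by (simp add: continuous_on_scaleR)
next
  case (Suc k)
  from Suc.prems(1) obtain f' where f': "\<And>x. x \<in> S \<Longrightarrow> (f has_derivative f' x) (at x)"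
      "\<And>v. Ck_on k S (\<lambda>x. f' x v)" by auto
  from Suc.prems(2) obtain g' where g': "\<And>x. x \<in> S \<Longrightarrow> (g has_derivative g' x) (at x)"
      "\<And>v. Ck_on k S (\<lambda>x. g' x v)" by auto
  have "Ck_on k S (\<lambda>x. f x *\<^sub>R g' x v + f' x v *\<^sub>R g x)" for v
    by (intro Ck_on_add Suc.IH Ck_on_Suc_imp_Ck_on[OF Suc.prems(1)]
        Ck_on_Suc_imp_Ck_on[OF Suc.prems(2)] f'(2) g'(2))
  then show ?case
    by (auto intro!: exI[of _ "\<lambda>x v. f x *\<^sub>R g' x v + f' x v *\<^sub>R g x"]
        has_derivative_scaleR f'(1) g'(1))
qed

lemma Ck_on_Pair: "Ck_on k S f \<Longrightarrow> Ck_on k S g \<Longrightarrow> Ck_on k S (\<lambda>x. (f x, g x))"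
proof (induction k arbitrary: f g)
  case 0
  then show ?case by (simp add: continuous_on_Pair)
next
  case (Suc k)
  from Suc.prems(1) obtain f' where f': "\<And>x. x \<in> S \<Longrightarrow> (f has_derivative f' x) (at x)"
      "\<And>v. Ck_on k S (\<lambda>x. f' x v)" by auto
  from Suc.prems(2) obtain g' where g': "\<And>x. x \<in> S \<Longrightarrow> (g has_derivative g' x) (at x)"
      "\<And>v. Ck_on k S (\<lambda>x. g' x v)" by auto
  from Suc.IH[OF f'(2) g'(2)] show ?case
    by (auto intro!: exI[of _ "\<lambda>x v. (f' x v, g' x v)"] has_derivative_Pair f'(1) g'(1))
qed

text \<open>The chain rule writes the derivative of \<open>g \<circ> f\<close> in a direction \<open>v\<close> as \<open>g'(f x)(f' x v)\<close>, where
  both the base point and the direction vary with \<open>x\<close>, while the definition of \<open>Ck_on\<close> only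
  controls derivatives in a fixed direction. Expanding \<open>f' x v\<close> in an orthonormal basis reduces one to
  the other; this is why the middle space is Euclidean.\<close>

lemma Ck_on_compose:
  fixes f :: "'a::real_normed_vector \<Rightarrow> 'b::euclidean_space"
  shows "Ck_on k T g \<Longrightarrow> Ck_on k S f \<Longrightarrow> f ` S \<subseteq> T \<Longrightarrow> Ck_on k S (\<lambda>x. g (f x))"
proof (induction k arbitrary: f g)
  case 0
  then show ?case by (auto intro: continuous_on_compose2)
next
  case (Suc k)
  from Suc.prems(1) obtain g' where g': "\<And>x. x \<in> T \<Longrightarrow> (g has_derivative g' x) (at x)"
      "\<And>v. Ck_on k T (\<lambda>x. g' x v)" by auto
  from Suc.prems(2) obtain f' where f': "\<And>x. x \<in> S \<Longrightarrow> (f has_derivative f' x) (at x)"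
      "\<And>v. Ck_on k S (\<lambda>x. f' x v)" by auto
  define h' where "h' = (\<lambda>x v. \<Sum>b\<in>Basis. (f' x v \<bullet> b) *\<^sub>R g' (f x) b)"
  have fk: "Ck_on k S f" by (rule Ck_on_Suc_imp_Ck_on[OF Suc.prems(2)])
  have "Ck_on k S (\<lambda>x. h' x v)" for v
    unfolding h'_def
    by (intro Ck_on_sum Ck_on_scaleR Ck_on_bounded_linear_compose[OF bounded_linear_inner_left]
        f'(2) Suc.IH[OF g'(2) fk Suc.prems(3)])
  moreover have "((\<lambda>x. g (f x)) has_derivative h' x) (at x)" if "x \<in> S" for x
  proof -
    have gx: "(g has_derivative g' (f x)) (at (f x))" using g'(1) Suc.prems(3) that by blast
    have "linear (g' (f x))" using gx has_derivative_linear by blast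
    then have "g' (f x) (f' x v) = h' x v" for v
      unfolding h'_def
      by (subst euclidean_representation[symmetric, of "f' x v"])
        (simp add: linear_sum linear_cmul)
    then show ?thesis
      using diff_chain_at[OF f'(1)[OF that] gx] by (simp add: o_def)
  qed
  ultimately show ?case by auto
qed

text \<open>Being \<open>C\<^sup>k\<close> is a local property: derivatives are taken in a full neighbourhood of the point, so they
  are unique, and the derivatives chosen on the members of an open cover agree on overlaps.\<close>

lemma Ck_on_open_cover:
  "(\<And>x. x \<in> S \<Longrightarrow> \<exists>T. open T \<and> x \<in> T \<and> Ck_on k T f) \<Longrightarrow> Ck_on k S f"
proof (induction k arbitrary: f)
  case 0
  show ?case
    using 0 unfolding Ck_on.simps
    by (meson continuous_at_imp_continuous_on continuous_on_eq_continuous_at)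
next
  case (Suc k)
  define f' where "f' = (\<lambda>x. frechet_derivative f (at x))"
  have f': "(f has_derivative f' x) (at x) \<and> (\<exists>T. open T \<and> x \<in> T \<and> Ck_on k T (\<lambda>x. f' x v))"
    if "x \<in> S" for x v
  proof -
    obtain T where T: "open T" "x \<in> T" "Ck_on (Suc k) T f" using Suc.prems[OF \<open>x \<in> S\<close>] by blast
    then obtain h where h: "\<And>y. y \<in> T \<Longrightarrow> (f has_derivative h y) (at y)"
      "\<And>v. Ck_on k T (\<lambda>y. h y v)" by auto
    have eq: "h y = f' y" if "y \<in> T" for y
      unfolding f'_def by (rule frechet_derivative_at[OF h(1)[OF that]])
    have "Ck_on k T (\<lambda>x. f' x v)"
      by (rule Ck_on_cong[OF T(1) _ h(2)]) (simp add: eq)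
    then show ?thesis using T h(1)[OF T(2)] eq[OF T(2)] by auto
  qed
  have "Ck_on k S (\<lambda>x. f' x v)" for v using f' by (intro Suc.IH) blast
  then show ?case using f' by auto
qed

section \<open>Symmetry of second derivatives\<close>

text \<open>Two applications of the mean value theorem, first in direction \<open>v\<close> to the difference of
  \<open>f\<close> across a step in direction \<open>w\<close>, then in direction \<open>w\<close> to the derivative along \<open>v\<close>.\<close>

lemma mixed_difference_mean_value:
  fixes f :: "'a::real_normed_vector \<Rightarrow> real"
  assumes f': "\<And>x. (f has_derivative f' x) (at x)"
    and f'': "\<And>x. ((\<lambda>x. f' x v) has_derivative f'' x) (at x)"
    and h: "h > 0"
  obtains a b where "0 < a" "a < h" "0 < b" "b < h"
    "f (x + h *\<^sub>R v + h *\<^sub>R w) - f (x + h *\<^sub>R v) - f (x + h *\<^sub>R w) + f x =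
      h\<^sup>2 * f'' (x + a *\<^sub>R v + b *\<^sub>R w) w"
proof -
  have fd: "((\<lambda>s. f (y + s *\<^sub>R v)) has_real_derivative f' (y + s *\<^sub>R v) v) (at s)" for y s
  proof -
    have "((\<lambda>s. f (y + s *\<^sub>R v)) has_derivative (\<lambda>t. f' (y + s *\<^sub>R v) (t *\<^sub>R v))) (at s)"
      by (rule has_derivative_compose[OF _ f', of "\<lambda>s. y + s *\<^sub>R v"]) (auto intro!: derivative_eq_intros)
    moreover have "linear (f' (y + s *\<^sub>R v))" using f' has_derivative_linear by blast
    ultimately show ?thesis
      by (simp add: has_field_derivative_def linear_cmul mult_commute_abs)
  qed
  have fd2: "((\<lambda>s. f' (y + s *\<^sub>R w) v) has_real_derivative f'' (y + s *\<^sub>R w) w) (at s)" for y s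
  proof -
    have "((\<lambda>s. f' (y + s *\<^sub>R w) v) has_derivative (\<lambda>t. f'' (y + s *\<^sub>R w) (t *\<^sub>R w))) (at s)"
      by (rule has_derivative_compose[OF _ f'', of "\<lambda>s. y + s *\<^sub>R w"]) (auto intro!: derivative_eq_intros)
    moreover have "linear (f'' (y + s *\<^sub>R w))" using f'' has_derivative_linear by blast
    ultimately show ?thesis
      by (simp add: has_field_derivative_def linear_cmul mult_commute_abs)
  qed
  have "\<exists>a. 0 < a \<and> a < h \<and>
      (f (x + h *\<^sub>R w + h *\<^sub>R v) - f (x + h *\<^sub>R v)) - (f (x + h *\<^sub>R w + 0 *\<^sub>R v) - f (x + 0 *\<^sub>R v)) =
      (h - 0) * (f' (x + h *\<^sub>R w + a *\<^sub>R v) v - f' (x + a *\<^sub>R v) v)"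
    by (rule MVT2[OF h]) (intro DERIV_diff fd)
  then obtain a where a: "0 < a" "a < h"
      "f (x + h *\<^sub>R w + h *\<^sub>R v) - f (x + h *\<^sub>R v) - f (x + h *\<^sub>R w) + f x =
      h * (f' (x + h *\<^sub>R w + a *\<^sub>R v) v - f' (x + a *\<^sub>R v) v)"
    by auto
  have "\<exists>b. 0 < b \<and> b < h \<and>
      f' (x + a *\<^sub>R v + h *\<^sub>R w) v - f' (x + a *\<^sub>R v + 0 *\<^sub>R w) v =
      (h - 0) * f'' (x + a *\<^sub>R v + b *\<^sub>R w) w"
    by (rule MVT2[OF h]) (intro fd2)
  then obtain b where b: "0 < b" "b < h"
      "f' (x + a *\<^sub>R v + h *\<^sub>R w) v - f' (x + a *\<^sub>R v) v = h * f'' (x + a *\<^sub>R v + b *\<^sub>R w) w"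
    by auto
  have sw: "x + h *\<^sub>R w + r *\<^sub>R v = x + r *\<^sub>R v + h *\<^sub>R w" for r by (simp add: ac_simps)
  show thesis
    using a(3) b(3) by (intro that[OF a(1,2) b(1,2)]) (simp add: sw power2_eq_square)
qed

text \<open>The second difference over a parallelogram is unchanged when the two sides are exchanged, and
  by the mean value form it is \<open>h\<^sup>2\<close> times either mixed derivative at a nearby point. Continuity then
  forces the two mixed derivatives at \<open>x\<close> to coincide.\<close>

lemma symmetric_second_derivative:
  fixes f :: "'a::real_normed_vector \<Rightarrow> real"
  assumes f': "\<And>x. (f has_derivative f' x) (at x)"
    and f'': "\<And>x v. ((\<lambda>x. f' x v) has_derivative f'' x v) (at x)"
    and cont: "\<And>v w. continuous_on UNIV (\<lambda>x. f'' x v w)"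
  shows "f'' x v w = f'' x w v"
proof (rule ccontr)
  assume ne: "f'' x v w \<noteq> f'' x w v"
  define e where "e = \<bar>f'' x v w - f'' x w v\<bar> / 2"
  have e: "e > 0" using ne by (simp add: e_def)
  have lim: "\<exists>d>0. \<forall>y. dist y x < d \<longrightarrow> \<bar>f'' y v w - f'' x v w\<bar> < e" for v w
    using cont[of v w] e unfolding continuous_on_iff dist_real_def by fastforce
  obtain d1 where d1: "d1 > 0" "\<And>y. dist y x < d1 \<Longrightarrow> \<bar>f'' y v w - f'' x v w\<bar> < e"
    using lim[of v w] by blast
  obtain d2 where d2: "d2 > 0" "\<And>y. dist y x < d2 \<Longrightarrow> \<bar>f'' y w v - f'' x w v\<bar> < e"
    using lim[of w v] by blast
  \<comment> \<open>Parallelogram sides of length factor \<open>h\<close> keep all intermediate points within both radii.\<close>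
  define N where "N = norm v + norm w + 1"
  have N: "N > 0" by (simp add: N_def add_nonneg_pos)
  define h where "h = min d1 d2 / N"
  have h: "h > 0" using d1(1) d2(1) N by (simp add: h_def)
  have small: "dist (x + a *\<^sub>R v' + b *\<^sub>R w') x < min d1 d2"
    if "0 < a" "a < h" "0 < b" "b < h" "norm v' + norm w' + 1 = N" for a b v' w'
  proof -
    have "norm (a *\<^sub>R v' + b *\<^sub>R w') \<le> a * norm v' + b * norm w'"
      using that norm_triangle_ineq[of "a *\<^sub>R v'" "b *\<^sub>R w'"] by simp
    also have "\<dots> \<le> h * norm v' + h * norm w'"
      using that by (intro add_mono mult_right_mono) auto
    also have "\<dots> < h * N" using that(5) h by (simp add: algebra_simps flip: that(5))
    finally show ?thesis using N by (simp add: dist_norm h_def add.assoc)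
  qed
  obtain a b where ab: "0 < a" "a < h" "0 < b" "b < h"
    "f (x + h *\<^sub>R v + h *\<^sub>R w) - f (x + h *\<^sub>R v) - f (x + h *\<^sub>R w) + f x =
      h\<^sup>2 * f'' (x + a *\<^sub>R v + b *\<^sub>R w) v w"
    using mixed_difference_mean_value[of f f' v "\<lambda>x. f'' x v" h x w, OF f' f'' h] by metis
  obtain a' b' where ab': "0 < a'" "a' < h" "0 < b'" "b' < h"
    "f (x + h *\<^sub>R w + h *\<^sub>R v) - f (x + h *\<^sub>R w) - f (x + h *\<^sub>R v) + f x =
      h\<^sup>2 * f'' (x + a' *\<^sub>R w + b' *\<^sub>R v) w v"
    using mixed_difference_mean_value[of f f' w "\<lambda>x. f'' x w" h x v, OF f' f'' h] by metis
  have swap: "x + h *\<^sub>R w + h *\<^sub>R v = x + h *\<^sub>R v + h *\<^sub>R w" by (simp add: ac_simps)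
  have "h\<^sup>2 * f'' (x + a *\<^sub>R v + b *\<^sub>R w) v w = h\<^sup>2 * f'' (x + a' *\<^sub>R w + b' *\<^sub>R v) w v"
    using ab(5) ab'(5)[unfolded swap] by linarith
  then have "f'' (x + a *\<^sub>R v + b *\<^sub>R w) v w = f'' (x + a' *\<^sub>R w + b' *\<^sub>R v) w v"
    using h by simp
  moreover have "\<bar>f'' (x + a *\<^sub>R v + b *\<^sub>R w) v w - f'' x v w\<bar> < e"
    using small[OF ab(1-4)] by (intro d1(2)) (simp add: N_def)
  moreover have "\<bar>f'' (x + a' *\<^sub>R w + b' *\<^sub>R v) w v - f'' x w v\<bar> < e"
    using small[OF ab'(1-4)] by (intro d2(2)) (simp add: N_def)
  ultimately have "\<bar>f'' x v w - f'' x w v\<bar> < 2 * e" by linarith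
  then show False by (simp add: e_def)
qed

lemma smooth_on_second_derivative:
  fixes f :: "'a::real_normed_vector \<Rightarrow> real"
  assumes "smooth_on UNIV f"
  obtains f' f'' where "\<And>x. (f has_derivative f' x) (at x)"
    "\<And>x v. ((\<lambda>x. f' x v) has_derivative f'' x v) (at x)"
    "\<And>x v w. f'' x v w = f'' x w v"
proof -
  have "Ck_on (Suc (Suc 0)) UNIV f" using assms unfolding smooth_on_def by blast
  then obtain f' where f': "\<And>x. (f has_derivative f' x) (at x)"
    "\<And>v. Ck_on (Suc 0) UNIV (\<lambda>x. f' x v)" unfolding Ck_on.simps(2)[of _ _ f] by auto
  have "\<forall>v. \<exists>D. (\<forall>x. ((\<lambda>x. f' x v) has_derivative D x) (at x)) \<and>
      (\<forall>w. continuous_on UNIV (\<lambda>x. D x w))"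
    using f'(2) by auto
  then obtain D where D: "\<And>v x. ((\<lambda>x. f' x v) has_derivative D v x) (at x)"
    "\<And>v w. continuous_on UNIV (\<lambda>x. D v x w)" by metis
  show thesis
  proof (rule that[of f' "\<lambda>x v. D v x", OF f'(1) D(1)])
    show "D v x w = D w x v" for x v w
      by (rule symmetric_second_derivative[of f f' "\<lambda>x v. D v x", OF f'(1) D(1) D(2)])
  qed
qed

lemma has_real_derivative_along_curve:
  assumes "(F has_derivative F') (at (c t))" "(c has_vector_derivative v) (at t)"
  shows "((\<lambda>t. F (c t)) has_real_derivative F' v) (at t)"
proof -
  have "((\<lambda>t. F (c t)) has_derivative (\<lambda>h. F' (h *\<^sub>R v))) (at t)"
    using diff_chain_at[OF assms(2)[unfolded has_vector_derivative_def] assms(1)] by (simp add: o_def)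
  then show ?thesis
    using has_derivative_linear[OF assms(1)]
    by (simp add: has_field_derivative_def linear_cmul mult_commute_abs)
qed


section \<open>Smooth maps between manifolds\<close>

text \<open>Composition and pairing of smooth maps use an atlas in two roles. On an intermediate manifold
  one picks a chart around the image point and cancels it against its inverse: this is
  \<open>charts_inj_cover\<close>. On the source one glues local statements in coordinates, for which charts have to
  be open maps: this is \<open>charts_open\<close>. The first property passes to \<open>prod_atlas\<close> directly, so that
  product charts can serve as intermediate ones.\<close>

definition charts_inj_cover :: "('m, 'e) atlas \<Rightarrow> bool" where
  "charts_inj_cover A \<longleftrightarrow>
     (\<forall>p. \<exists>U \<phi>. (U, \<phi>) \<in> A \<and> p \<in> U) \<and> (\<forall>U \<phi>. (U, \<phi>) \<in> A \<longrightarrow> inj_on \<phi> U)"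

definition charts_open :: "('m::topological_space, 'e::topological_space) atlas \<Rightarrow> bool" where
  "charts_open A \<longleftrightarrow>
     (\<forall>U \<phi>. (U, \<phi>) \<in> A \<longrightarrow> open U \<and> (\<forall>W. open W \<longrightarrow> open (\<phi> ` (U \<inter> W))))"

lemma smooth_atlas_iff:
  "smooth_atlas A \<longleftrightarrow>
     (\<forall>p. \<exists>U \<phi>. (U, \<phi>) \<in> A \<and> p \<in> U) \<and>
     (\<forall>U \<phi>. (U, \<phi>) \<in> A \<longrightarrow>
        open U \<and> open (\<phi> ` U) \<and> homeomorphism U (\<phi> ` U) \<phi> (inv_into U \<phi>)) \<and>
     (\<forall>U \<phi> V \<psi>. (U, \<phi>) \<in> A \<longrightarrow> (V, \<psi>) \<in> A \<longrightarrow>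
        smooth_on (\<phi> ` (U \<inter> V)) (\<psi> \<circ> inv_into U \<phi>))"
proof -
  have "(\<Union>(U, \<phi>)\<in>A. U) = UNIV \<longleftrightarrow> (\<forall>p. \<exists>U \<phi>. (U, \<phi>) \<in> A \<and> p \<in> U)"
    by (simp only: set_eq_iff UN_iff Bex_def split_paired_Ex case_prod_conv UNIV_I simp_thms)
  then show ?thesis
    by (simp only: smooth_atlas_def Ball_def split_paired_All case_prod_conv) meson
qed

lemma smooth_map_iff:
  "smooth_map A B f \<longleftrightarrow> continuous_on UNIV f \<and>
     (\<forall>U \<phi> V \<psi> k. (U, \<phi>) \<in> A \<longrightarrow> (V, \<psi>) \<in> B \<longrightarrow>
        Ck_on k (\<phi> ` (U \<inter> f -` V)) (\<psi> \<circ> f \<circ> inv_into U \<phi>))"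
  by (simp only: smooth_map_def smooth_on_def Ball_def split_paired_All case_prod_conv) meson

lemma smooth_atlas_charts_inj_cover:
  assumes "smooth_atlas A"
  shows "charts_inj_cover A"
proof -
  have "inj_on \<phi> U" if "(U, \<phi>) \<in> A" for U \<phi>
  proof -
    have "homeomorphism U (\<phi> ` U) \<phi> (inv_into U \<phi>)"
      using assms that unfolding smooth_atlas_iff by simp
    then show ?thesis unfolding homeomorphism_def by (metis inj_on_inverseI)
  qed
  then show ?thesis using assms unfolding smooth_atlas_iff charts_inj_cover_def by simp
qed

lemma smooth_atlas_charts_open:
  assumes "smooth_atlas A"
  shows "charts_open A"
proof -
  have "open U \<and> open (\<phi> ` (U \<inter> W))" if "(U, \<phi>) \<in> A" "open W" for U \<phi> W
  proof -
    have U: "open U" "open (\<phi> ` U)" "homeomorphism U (\<phi> ` U) \<phi> (inv_into U \<phi>)"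
      using assms that(1) unfolding smooth_atlas_iff by simp_all
    have "openin (top_of_set (\<phi> ` U)) (\<phi> ` (U \<inter> W))"
      using U(1) that(2) by (intro homeomorphism_imp_open_map[OF U(3)]) (auto simp: openin_open)
    then show ?thesis using U openin_open_eq by blast
  qed
  then show ?thesis unfolding charts_open_def by (metis open_UNIV)
qed

lemma std_atlas_charts: "charts_inj_cover std_atlas" "charts_open std_atlas"
  by (auto simp: std_atlas_def charts_inj_cover_def charts_open_def)

lemma prod_atlas_charts_inj_cover:
  assumes "charts_inj_cover A" "charts_inj_cover B"
  shows "charts_inj_cover (prod_atlas A B)"
  unfolding charts_inj_cover_def
proof (intro conjI allI impI)
  fix z
  obtain U \<phi> V \<psi> where "(U, \<phi>) \<in> A" "fst z \<in> U" "(V, \<psi>) \<in> B" "snd z \<in> V"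
    using assms unfolding charts_inj_cover_def by metis
  then have "(U \<times> V, map_prod \<phi> \<psi>) \<in> prod_atlas A B" "z \<in> U \<times> V"
    unfolding prod_atlas_def by (auto simp: mem_Times_iff)
  then show "\<exists>U \<phi>. (U, \<phi>) \<in> prod_atlas A B \<and> z \<in> U" by blast
next
  fix Q \<omega> assume "(Q, \<omega>) \<in> prod_atlas A B"
  then obtain U \<phi> V \<psi> where "(U, \<phi>) \<in> A" "(V, \<psi>) \<in> B" "Q = U \<times> V" "\<omega> = map_prod \<phi> \<psi>"
    unfolding prod_atlas_def by auto
  then show "inj_on \<omega> Q"
    using assms map_prod_inj_on unfolding charts_inj_cover_def by metis
qed

text \<open>The definition of smoothness asks for regularity on the whole coordinate image of
  \<open>U \<inter> h -` V\<close>. Checking it on a neighbourhood \<open>W\<close> of each point suffices, and \<open>W\<close> may be shrunk until it is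
  mapped into a single chart of an intermediate manifold.\<close>

lemma smooth_mapI:
  fixes A :: "('m::topological_space, 'e::euclidean_space) atlas"
    and B :: "('n::topological_space, 'f::euclidean_space) atlas"
  assumes A: "charts_inj_cover A" "charts_open A"
    and cont: "continuous_on UNIV h"
    and loc: "\<And>p U \<phi> V \<psi>. (U, \<phi>) \<in> A \<Longrightarrow> (V, \<psi>) \<in> B \<Longrightarrow> p \<in> U \<Longrightarrow> h p \<in> V \<Longrightarrow>
      \<exists>W. open W \<and> p \<in> W \<and> (\<forall>k. Ck_on k (\<phi> ` (U \<inter> W)) (\<psi> \<circ> h \<circ> inv_into U \<phi>))"
  shows "smooth_map A B h"
proof -
  have "Ck_on k (\<phi> ` (U \<inter> h -` V)) (\<psi> \<circ> h \<circ> inv_into U \<phi>)"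
    if UV: "(U, \<phi>) \<in> A" "(V, \<psi>) \<in> B" for U \<phi> V \<psi> k
  proof (rule Ck_on_open_cover)
    fix y assume "y \<in> \<phi> ` (U \<inter> h -` V)"
    then obtain p where p: "p \<in> U" "h p \<in> V" "y = \<phi> p" by auto
    from loc[OF UV p(1,2)] obtain W where "open W" "p \<in> W"
      "Ck_on k (\<phi> ` (U \<inter> W)) (\<psi> \<circ> h \<circ> inv_into U \<phi>)" by blast
    moreover have "open (\<phi> ` (U \<inter> W))"
      using A(2) UV(1) \<open>open W\<close> unfolding charts_open_def by simp
    ultimately show "\<exists>T. open T \<and> y \<in> T \<and> Ck_on k T (\<psi> \<circ> h \<circ> inv_into U \<phi>)"
      using p by blast
  qed
  then show ?thesis using cont unfolding smooth_map_iff by simp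
qed

lemma smooth_map_Ck_on:
  assumes "smooth_map A B h" "(U, \<phi>) \<in> A" "(V, \<psi>) \<in> B"
  shows "Ck_on k (\<phi> ` (U \<inter> h -` V)) (\<psi> \<circ> h \<circ> inv_into U \<phi>)"
  using assms unfolding smooth_map_iff by simp

lemma smooth_map_continuous: "smooth_map A B h \<Longrightarrow> continuous_on UNIV h"
  unfolding smooth_map_iff by simp

lemma charts_openD: "charts_open A \<Longrightarrow> (U, \<phi>) \<in> A \<Longrightarrow> open U"
  unfolding charts_open_def by simp

lemma smooth_map_compose:
  assumes A: "charts_inj_cover A" "charts_open A" and B: "charts_inj_cover B" "\<And>V \<psi>. (V, \<psi>) \<in> B \<Longrightarrow> open V"
    and f: "smooth_map A B f" and g: "smooth_map B C g" and C: "\<And>W \<eta>. (W, \<eta>) \<in> C \<Longrightarrow> open W"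
  shows "smooth_map A C (\<lambda>p. g (f p))"
proof (rule smooth_mapI[OF A])
  note cf = smooth_map_continuous[OF f] and cg = smooth_map_continuous[OF g]
  show "continuous_on UNIV (\<lambda>p. g (f p))"
    using continuous_on_compose2[OF cg cf] by simp
  fix p U \<phi> W \<eta>
  assume UW: "(U, \<phi>) \<in> A" "(W, \<eta>) \<in> C" "p \<in> U" "g (f p) \<in> W"
  obtain V \<psi> where V: "(V, \<psi>) \<in> B" "f p \<in> V" "inj_on \<psi> V"
    using B(1) unfolding charts_inj_cover_def by metis
  have injU: "inj_on \<phi> U" using A(1) UW(1) unfolding charts_inj_cover_def by metis
  define N where "N = f -` V \<inter> (\<lambda>p. g (f p)) -` W"
  have "open (f -` V)" using cf B(2)[OF V(1)] by (simp add: open_vimage)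
  moreover have "open ((\<lambda>p. g (f p)) -` W)"
    using continuous_on_compose2[OF cg cf] C[OF UW(2)] by (simp add: open_vimage)
  ultimately have N: "open N" "p \<in> N" using UW V by (auto simp: N_def)
  have "Ck_on k (\<phi> ` (U \<inter> N)) (\<eta> \<circ> (\<lambda>p. g (f p)) \<circ> inv_into U \<phi>)" for k
  proof -
    have eq: "(\<psi> \<circ> f \<circ> inv_into U \<phi>) (\<phi> q) = \<psi> (f q)" if "q \<in> U" for q
      using that injU by simp
    have "Ck_on k (\<phi> ` (U \<inter> N))
        (\<lambda>y. (\<eta> \<circ> g \<circ> inv_into V \<psi>) ((\<psi> \<circ> f \<circ> inv_into U \<phi>) y))"
    proof (rule Ck_on_compose[OF smooth_map_Ck_on[OF g V(1) UW(2)]])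
      show "Ck_on k (\<phi> ` (U \<inter> N)) (\<psi> \<circ> f \<circ> inv_into U \<phi>)"
        by (rule Ck_on_subset[OF smooth_map_Ck_on[OF f UW(1) V(1)]]) (auto simp: N_def)
      show "(\<psi> \<circ> f \<circ> inv_into U \<phi>) ` \<phi> ` (U \<inter> N) \<subseteq> \<psi> ` (V \<inter> g -` W)"
        using eq by (auto simp: N_def)
    qed
    moreover have "open (\<phi> ` (U \<inter> N))" using A(2) UW(1) N(1) unfolding charts_open_def by simp
    moreover have "(\<eta> \<circ> g \<circ> inv_into V \<psi>) ((\<psi> \<circ> f \<circ> inv_into U \<phi>) y) =
        (\<eta> \<circ> (\<lambda>p. g (f p)) \<circ> inv_into U \<phi>) y" if y: "y \<in> \<phi> ` (U \<inter> N)" for y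
    proof -
      obtain q where q: "q \<in> U" "q \<in> N" "y = \<phi> q" using y by auto
      then have "f q \<in> V" by (simp add: N_def)
      then show ?thesis using q injU V(3) by simp
    qed
    ultimately show ?thesis by (rule Ck_on_cong[rotated 2])
  qed
  then show "\<exists>W. open W \<and> p \<in> W \<and> (\<forall>k. Ck_on k (\<phi> ` (U \<inter> W)) (\<eta> \<circ> (\<lambda>p. g (f p)) \<circ> inv_into U \<phi>))"
    using N by blast
qed

lemma smooth_map_Pair:
  assumes A: "charts_inj_cover A" "charts_open A"
    and B: "\<And>V \<psi>. (V, \<psi>) \<in> B \<Longrightarrow> open V" and C: "\<And>W \<eta>. (W, \<eta>) \<in> C \<Longrightarrow> open W"
    and f: "smooth_map A B f" and g: "smooth_map A C g"
  shows "smooth_map A (prod_atlas B C) (\<lambda>p. (f p, g p))"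
proof (rule smooth_mapI[OF A])
  note cf = smooth_map_continuous[OF f] and cg = smooth_map_continuous[OF g]
  show "continuous_on UNIV (\<lambda>p. (f p, g p))"
    using continuous_on_Pair[OF cf cg] .
  fix p U \<phi> Q \<omega>
  assume UQ: "(U, \<phi>) \<in> A" "(Q, \<omega>) \<in> prod_atlas B C" "p \<in> U" "(f p, g p) \<in> Q"
  then obtain V \<psi> W \<eta> where V: "(V, \<psi>) \<in> B" and W: "(W, \<eta>) \<in> C"
    and Q: "Q = V \<times> W" "\<omega> = map_prod \<psi> \<eta>"
    unfolding prod_atlas_def by auto
  define N where "N = f -` V \<inter> g -` W"
  have "open (f -` V)" "open (g -` W)" using cf B[OF V] cg C[OF W] by (simp_all add: open_vimage)
  then have N: "open N" "p \<in> N" using UQ Q by (auto simp: N_def)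
  have "Ck_on k (\<phi> ` (U \<inter> N)) (\<lambda>y. ((\<psi> \<circ> f \<circ> inv_into U \<phi>) y, (\<eta> \<circ> g \<circ> inv_into U \<phi>) y))" for k
    by (intro Ck_on_Pair Ck_on_subset[OF smooth_map_Ck_on[OF f UQ(1) V]]
        Ck_on_subset[OF smooth_map_Ck_on[OF g UQ(1) W]]) (auto simp: N_def)
  moreover have "(\<lambda>y. ((\<psi> \<circ> f \<circ> inv_into U \<phi>) y, (\<eta> \<circ> g \<circ> inv_into U \<phi>) y)) =
      \<omega> \<circ> (\<lambda>p. (f p, g p)) \<circ> inv_into U \<phi>"
    by (auto simp: Q)
  ultimately show "\<exists>N. open N \<and> p \<in> N \<and>
      (\<forall>k. Ck_on k (\<phi> ` (U \<inter> N)) (\<omega> \<circ> (\<lambda>p. (f p, g p)) \<circ> inv_into U \<phi>))"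
    using N by auto
qed

lemma smooth_map_const: "smooth_map A B (\<lambda>_. q)"
  unfolding smooth_map_iff by (simp add: o_def Ck_on_const)

lemma smooth_map_id: "smooth_atlas A \<Longrightarrow> smooth_map A A (\<lambda>p. p)"
  unfolding smooth_map_iff smooth_atlas_iff smooth_on_def by (simp add: o_def)

lemma smooth_map_std_iff: "smooth_map std_atlas std_atlas f \<longleftrightarrow> smooth_on UNIV f"
proof -
  have "inv_into UNIV id = (id :: 'a \<Rightarrow> 'a)" by (metis inv_id)
  moreover have "continuous_on UNIV f" if "smooth_on UNIV f"
    using that unfolding smooth_on_def by (metis Ck_on.simps(1))
  ultimately show ?thesis unfolding smooth_map_def std_atlas_def by auto
qed

lemma smooth_map_bounded_linear:
  "bounded_linear L \<Longrightarrow> smooth_map std_atlas std_atlas L"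
  unfolding smooth_map_std_iff smooth_on_def by (auto intro: Ck_on_bounded_linear)




section \<open>One-parameter subgroups and the adjoint action\<close>

locale smooth_group =
  fixes G :: "'g::{t2_space,second_countable_topology} monoid" (structure)
    and A :: "('g, 'e::euclidean_space) atlas"
  assumes lie_group: "lie_group G A"
begin

sublocale group G
  using lie_group unfolding lie_group_def by simp

lemma in_carrier [simp]: "p \<in> carrier G"
  using lie_group unfolding lie_group_def by simp

lemma smooth_atlas: "smooth_atlas A"
  using lie_group unfolding lie_group_def by simp

lemmas charts = smooth_atlas_charts_inj_cover[OF smooth_atlas] smooth_atlas_charts_open[OF smooth_atlas]

lemma chart_open: "(V, \<psi>) \<in> A \<Longrightarrow> open V"
  using charts_openD[OF charts(2)] .

lemma smooth_map_mult:
  assumes B: "charts_inj_cover B" "charts_open B"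
    and f: "smooth_map B A f" and g: "smooth_map B A g"
  shows "smooth_map B A (\<lambda>p. f p \<otimes> g p)"
proof -
  have m: "smooth_map (prod_atlas A A) A (\<lambda>(p, q). p \<otimes> q)"
    using lie_group unfolding lie_group_def by simp
  have "open Q" if "(Q, \<omega>) \<in> prod_atlas A A" for Q \<omega>
    using that chart_open unfolding prod_atlas_def by (auto intro: open_Times)
  then have "smooth_map B A (\<lambda>p. (\<lambda>(p, q). p \<otimes> q) (f p, g p))"
    by (intro smooth_map_compose[OF B prod_atlas_charts_inj_cover[OF charts(1) charts(1)] _
          smooth_map_Pair[OF B chart_open chart_open f g] m chart_open])
  then show ?thesis by simp
qed

lemma smooth_fun_compose:
  assumes B: "charts_inj_cover B" "charts_open B" and h: "smooth_map B A h" and f: "smooth_fun A f"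
  shows "smooth_fun B (\<lambda>p. f (h p))"
  by (rule smooth_map_compose[OF B charts(1) chart_open h f]) (auto simp: std_atlas_def)

lemma smooth_fun_left_translate: "smooth_fun A f \<Longrightarrow> smooth_fun A (\<lambda>q. f (p \<otimes> q))"
  by (rule smooth_fun_compose[OF charts smooth_map_mult[OF charts smooth_map_const smooth_map_id[OF smooth_atlas]]])

lemma smooth_fun_right_translate: "smooth_fun A f \<Longrightarrow> smooth_fun A (\<lambda>q. f (q \<otimes> p))"
  by (rule smooth_fun_compose[OF charts smooth_map_mult[OF charts smooth_map_id[OF smooth_atlas] smooth_map_const]])

lemma smooth_fun_scale: "smooth_fun A f \<Longrightarrow> smooth_fun A (\<lambda>q. c * f q)"
  by (rule smooth_map_compose[OF charts std_atlas_charts(1) _ _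
        smooth_map_bounded_linear[OF bounded_linear_mult_right]])
    (auto simp: std_atlas_def)

text \<open>The relation between a one-parameter subgroup and a field from which \<open>lie_exp\<close> chooses its value.\<close>

definition generates :: "(real \<Rightarrow> 'g) \<Rightarrow> 'g vfield \<Rightarrow> bool" where
  "generates \<gamma> Y \<longleftrightarrow> one_parameter_subgroup G A \<gamma> \<and>
     (\<forall>f. smooth_fun A f \<longrightarrow> ((\<lambda>t. f (\<gamma> t)) has_real_derivative Y \<one> f) (at 0))"

lemma generates_add: "generates \<gamma> Y \<Longrightarrow> \<gamma> (t + u) = \<gamma> t \<otimes> \<gamma> u"
  unfolding generates_def one_parameter_subgroup_def by simp

lemma generates_zero:
  assumes "generates \<gamma> Y"
  shows "\<gamma> 0 = \<one>"
proof -
  have "\<gamma> 0 \<otimes> \<gamma> 0 = \<gamma> 0" using generates_add[OF assms, of 0 0] by simp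
  then show ?thesis by (metis in_carrier r_cancel_one)
qed

lemma generates_smooth: "generates \<gamma> Y \<Longrightarrow> smooth_map std_atlas A \<gamma>"
  unfolding generates_def one_parameter_subgroup_def by simp

lemma lie_algebra_left_invariant:
  assumes "Y \<in> lie_algebra G A" "smooth_fun A f"
  shows "Y (p \<otimes> q) f = Y q (\<lambda>r. f (p \<otimes> r))"
  using assms unfolding lie_algebra_def left_invariant_def differential_def by (simp add: o_def)

lemma lie_algebra_smooth:
  "Y \<in> lie_algebra G A \<Longrightarrow> smooth_fun A f \<Longrightarrow> smooth_fun A (\<lambda>q. Y q f)"
  unfolding lie_algebra_def smooth_vfield_def by simp

lemma lie_algebra_not_smooth: "Y \<in> lie_algebra G A \<Longrightarrow> \<not> smooth_fun A f \<Longrightarrow> Y q f = 0"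
  unfolding lie_algebra_def smooth_vfield_def tangent_space_def by simp

lemma lie_algebra_add:
  "Y \<in> lie_algebra G A \<Longrightarrow> smooth_fun A f \<Longrightarrow> smooth_fun A g \<Longrightarrow>
    Y q (\<lambda>r. f r + g r) = Y q f + Y q g"
  unfolding lie_algebra_def smooth_vfield_def tangent_space_def by simp

lemma lie_algebra_scale:
  "Y \<in> lie_algebra G A \<Longrightarrow> smooth_fun A f \<Longrightarrow> Y q (\<lambda>r. c * f r) = c * Y q f"
  unfolding lie_algebra_def smooth_vfield_def tangent_space_def by simp

text \<open>The flow of a left-invariant field is right multiplication by its one-parameter subgroup.\<close>

lemma flow_derivative:
  assumes Y: "Y \<in> lie_algebra G A" and gen: "generates \<gamma> Y" and f: "smooth_fun A f"
  shows "((\<lambda>t. f (p \<otimes> \<gamma> t)) has_real_derivative Y (p \<otimes> \<gamma> t) f) (at t)"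
proof -
  let ?q = "p \<otimes> \<gamma> t"
  have "((\<lambda>h. f (?q \<otimes> \<gamma> h)) has_real_derivative Y \<one> (\<lambda>r. f (?q \<otimes> r))) (at 0)"
    using gen[unfolded generates_def, THEN conjunct2, rule_format,
        OF smooth_fun_left_translate[OF f, of ?q]] .
  moreover have "Y \<one> (\<lambda>r. f (?q \<otimes> r)) = Y ?q f"
    using lie_algebra_left_invariant[OF Y f, of ?q \<one>] by simp
  moreover have "(\<lambda>h. f (?q \<otimes> \<gamma> h)) = (\<lambda>h. f (p \<otimes> \<gamma> (h + t)))"
    using generates_add[OF gen, of t] by (simp add: m_assoc add.commute[of _ t])
  ultimately have "((\<lambda>h. f (p \<otimes> \<gamma> (h + t))) has_real_derivative Y ?q f) (at 0)" by simp
  then show ?thesis using DERIV_shift[of "\<lambda>t. f (p \<otimes> \<gamma> t)" _ 0 t] by simp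
qed

text \<open>This is the differential equation of the adjoint action. With \<open>F(t)\<close> the translate of \<open>Y(\<gamma>(t))\<close> to the
  identity by right multiplication with \<open>\<gamma>(-t)\<close>, that is \<open>F(t) = Ad(\<gamma>(t)) Y\<close>, it says that \<open>F'\<close> is the same
  expression for \<open>[Z, Y]\<close>.

  Everything is read off from the function \<open>H(a, u, b) = f(\<gamma>(a) \<eta>(u) \<gamma>(b))\<close> of three real variables. Its
  derivative in \<open>u\<close> at \<open>(t, 0, -t)\<close> is the function to be differentiated, so the derivative in \<open>t\<close> is
  \<open>\<partial>\<^sub>a\<partial>\<^sub>u H - \<partial>\<^sub>b\<partial>\<^sub>u H\<close>. The first term is \<open>Z Y g\<close> with \<open>g(q) = f(q \<gamma>(-t))\<close>. In the second the order of
  differentiation is exchanged; since \<open>\<gamma>(h - t) = \<gamma>(h) \<gamma>(-t)\<close>, differentiating first in \<open>b\<close> applies \<open>Z\<close> to \<open>g\<close> at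
  \<open>\<gamma>(t) \<eta>(u)\<close>, and the derivative in \<open>u\<close> then gives \<open>Y Z g\<close>.\<close>

lemma conjugation_derivative:
  assumes Z: "Z \<in> lie_algebra G A" "generates \<gamma> Z"
    and Y: "Y \<in> lie_algebra G A" "generates \<eta> Y"
    and f: "smooth_fun A f"
  shows "((\<lambda>t. Y (\<gamma> t) (\<lambda>q. f (q \<otimes> \<gamma> (- t)))) has_real_derivative
      lie_bracket Z Y (\<gamma> t) (\<lambda>q. f (q \<otimes> \<gamma> (- t)))) (at t)"
proof -
  define H where "H = (\<lambda>z::real \<times> real \<times> real. f (\<gamma> (fst z) \<otimes> \<eta> (fst (snd z)) \<otimes> \<gamma> (snd (snd z))))"
  note comp = smooth_map_compose[OF std_atlas_charts std_atlas_charts(1) _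
      smooth_map_bounded_linear _ chart_open]
  have lin: "bounded_linear (\<lambda>z::real \<times> real \<times> real. fst z)"
    "bounded_linear (\<lambda>z::real \<times> real \<times> real. fst (snd z))"
    "bounded_linear (\<lambda>z::real \<times> real \<times> real. snd (snd z))"
    by (intro bounded_linear_fst bounded_linear_snd bounded_linear_fst_comp bounded_linear_snd_comp)+
  have std_open: "\<And>V \<psi>. (V, \<psi> :: real \<Rightarrow> real) \<in> std_atlas \<Longrightarrow> open V" by (simp add: std_atlas_def)
  have "smooth_map std_atlas A (\<lambda>z::real \<times> real \<times> real. \<gamma> (fst z) \<otimes> \<eta> (fst (snd z)) \<otimes> \<gamma> (snd (snd z)))"
    by (intro smooth_map_mult std_atlas_charts
        comp[OF std_open lin(1) generates_smooth[OF Z(2)]]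
        comp[OF std_open lin(2) generates_smooth[OF Y(2)]]
        comp[OF std_open lin(3) generates_smooth[OF Z(2)]])
  then have "smooth_fun std_atlas H"
    unfolding H_def by (rule smooth_fun_compose[OF std_atlas_charts _ f])
  then have "smooth_on UNIV H" unfolding smooth_map_std_iff .
  then obtain H' H'' where H': "\<And>z. (H has_derivative H' z) (at z)"
    and H'': "\<And>z v. ((\<lambda>z. H' z v) has_derivative H'' z v) (at z)"
    and sym: "\<And>z v w. H'' z v w = H'' z w v"
    using smooth_on_second_derivative by blast
  define g where "g = (\<lambda>b q. f (q \<otimes> \<gamma> b))"
  have g: "smooth_fun A (g b)" for b unfolding g_def by (rule smooth_fun_right_translate[OF f])
  note vd = has_real_derivative_along_curve
  have c1: "((\<lambda>a. (a, u, b)) has_vector_derivative (1, 0, 0)) (at a)" for a u b :: real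
    unfolding has_vector_derivative_def
    by (auto intro!: derivative_eq_intros simp: zero_prod_def)
  have c2: "((\<lambda>u. (a, u, b)) has_vector_derivative (0, 1, 0)) (at u)" for a u b :: real
    unfolding has_vector_derivative_def by (auto intro!: derivative_eq_intros)
  have c3: "((\<lambda>b. (a, u, b)) has_vector_derivative (0, 0, 1)) (at b)" for a u b :: real
    unfolding has_vector_derivative_def by (auto intro!: derivative_eq_intros)
  have c13: "((\<lambda>t. (t, 0, - t)) has_vector_derivative (1, 0, - 1)) (at t)" for t :: real
    unfolding has_vector_derivative_def by (auto intro!: derivative_eq_intros)
  have H2: "H' (a, 0, b) (0, 1, 0) = Y (\<gamma> a) (g b)" for a b
  proof (rule DERIV_unique)
    show "((\<lambda>u. H (a, u, b)) has_real_derivative H' (a, 0, b) (0, 1, 0)) (at 0)"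
      by (rule vd[OF H' c2])
    show "((\<lambda>u. H (a, u, b)) has_real_derivative Y (\<gamma> a) (g b)) (at 0)"
      using flow_derivative[OF Y g, of b "\<gamma> a" 0]
      by (simp add: generates_zero[OF Y(2)] g_def H_def)
  qed
  have H3: "H' (a, u, b) (0, 0, 1) = Z (\<gamma> a \<otimes> \<eta> u) (g b)" for a u b
  proof (rule DERIV_unique)
    show "((\<lambda>v. H (a, u, v)) has_real_derivative H' (a, u, b) (0, 0, 1)) (at b)"
      by (rule vd[OF H' c3])
    have "((\<lambda>h. g b (\<gamma> a \<otimes> \<eta> u \<otimes> \<gamma> h)) has_real_derivative Z (\<gamma> a \<otimes> \<eta> u) (g b)) (at 0)"
      using flow_derivative[OF Z g, of b "\<gamma> a \<otimes> \<eta> u" 0] by (simp add: generates_zero[OF Z(2)])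
    moreover have "(\<lambda>h. g b (\<gamma> a \<otimes> \<eta> u \<otimes> \<gamma> h)) = (\<lambda>h. H (a, u, h + b))"
      by (simp add: g_def H_def m_assoc generates_add[OF Z(2)])
    ultimately show "((\<lambda>v. H (a, u, v)) has_real_derivative Z (\<gamma> a \<otimes> \<eta> u) (g b)) (at b)"
      using DERIV_shift[of "\<lambda>v. H (a, u, v)" _ 0 b] by simp
  qed
  have H21: "H'' (t, 0, b) (0, 1, 0) (1, 0, 0) = Z (\<gamma> t) (\<lambda>q. Y q (g b))" for b
  proof (rule DERIV_unique)
    show "((\<lambda>a. H' (a, 0, b) (0, 1, 0)) has_real_derivative H'' (t, 0, b) (0, 1, 0) (1, 0, 0)) (at t)"
      by (rule vd[OF H'' c1])
    show "((\<lambda>a. H' (a, 0, b) (0, 1, 0)) has_real_derivative Z (\<gamma> t) (\<lambda>q. Y q (g b))) (at t)"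
      using flow_derivative[OF Z lie_algebra_smooth[OF Y(1) g], where p = \<one> and t = t] by (simp add: H2)
  qed
  have H32: "H'' (t, 0, b) (0, 0, 1) (0, 1, 0) = Y (\<gamma> t) (\<lambda>q. Z q (g b))" for b
  proof (rule DERIV_unique)
    show "((\<lambda>u. H' (t, u, b) (0, 0, 1)) has_real_derivative H'' (t, 0, b) (0, 0, 1) (0, 1, 0)) (at 0)"
      by (rule vd[OF H'' c2])
    show "((\<lambda>u. H' (t, u, b) (0, 0, 1)) has_real_derivative Y (\<gamma> t) (\<lambda>q. Z q (g b))) (at 0)"
      using flow_derivative[OF Y lie_algebra_smooth[OF Z(1) g], where p = "\<gamma> t" and t = 0]
      by (simp add: H3 generates_zero[OF Y(2)])
  qed
  have "((\<lambda>t. H' (t, 0, - t) (0, 1, 0)) has_real_derivative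
      H'' (t, 0, - t) (0, 1, 0) (1, 0, - 1)) (at t)"
    by (rule vd[OF H'' c13])
  moreover have "H'' (t, 0, - t) (0, 1, 0) (1, 0, - 1) = lie_bracket Z Y (\<gamma> t) (g (- t))"
  proof -
    have "linear (H'' (t, 0, - t) (0, 1, 0))" by (rule has_derivative_linear[OF H''])
    from linear_diff[OF this, of "(1, 0, 0)" "(0, 0, 1)"]
    have "H'' (t, 0, - t) (0, 1, 0) (1, 0, - 1) =
        H'' (t, 0, - t) (0, 1, 0) (1, 0, 0) - H'' (t, 0, - t) (0, 1, 0) (0, 0, 1)" by simp
    then show ?thesis
      using sym[of "(t, 0, - t)" "(0, 1, 0)" "(0, 0, 1)"]
      by (simp add: H21 H32 lie_bracket_def)
  qed
  ultimately show ?thesis by (simp add: H2 g_def)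
qed

lemma right_invariant_vf_apply:
  "right_invariant_vf G A Y p f = (if smooth_fun A f then Y \<one> (\<lambda>q. f (q \<otimes> p)) else 0)"
  unfolding right_invariant_vf_def differential_def by (simp add: o_def)

text \<open>The identity \<open>Y(p) = dR\<^sub>p (e\<^bsup>ad Z\<^esup> Y)(e)\<close> for \<open>p = \<gamma>(1)\<close>. The functions \<open>\<Phi> m\<close> of the proof belong to the
  iterated brackets \<open>ad\<^sub>Z\<^sup>m Y\<close>; each is the derivative of the preceding one by
  \<open>conjugation_derivative\<close>, and \<open>\<Phi> N\<close> vanishes. So Taylor's formula for \<open>\<Phi> 0\<close> between \<open>0\<close> and \<open>1\<close> is a finite sum without
  remainder. The test function is pre-translated by \<open>\<gamma>(1)\<close>, which turns the value at \<open>1\<close> into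
  \<open>Y(p) f\<close> and the values at \<open>0\<close> into those of right-invariant fields at \<open>p\<close>.\<close>

lemma left_invariant_eq_exp_ad_right_invariant:
  assumes Z: "Z \<in> lie_algebra G A" "generates \<gamma> Z"
    and Y: "\<And>m. (lie_bracket Z ^^ m) Y \<in> lie_algebra G A"
      "\<And>m. \<exists>\<eta>. generates \<eta> ((lie_bracket Z ^^ m) Y)"
    and nilpotent: "(lie_bracket Z ^^ N) Y = 0"
  shows "Y (\<gamma> 1) f = (\<Sum>m<N. 1 / fact m * right_invariant_vf G A ((lie_bracket Z ^^ m) Y) (\<gamma> 1) f)"
proof (cases "smooth_fun A f")
  case True
  define h where "h = (\<lambda>q. f (q \<otimes> \<gamma> 1))"
  have h: "smooth_fun A h" unfolding h_def by (rule smooth_fun_right_translate[OF True])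
  define \<Phi> where "\<Phi> = (\<lambda>m t. ((lie_bracket Z ^^ m) Y) (\<gamma> t) (\<lambda>q. h (q \<otimes> \<gamma> (- t))))"
  have "\<forall>m t. DERIV (\<Phi> m) t :> \<Phi> (Suc m) t"
  proof (intro allI)
    fix m t
    obtain \<eta> where "generates \<eta> ((lie_bracket Z ^^ m) Y)" using Y(2) by blast
    from conjugation_derivative[OF Z Y(1) this h, of t]
    show "DERIV (\<Phi> m) t :> \<Phi> (Suc m) t" by (simp add: \<Phi>_def)
  qed
  from Maclaurin_all_le[OF refl this, of 1 N] obtain t where
    "\<Phi> 0 1 = (\<Sum>m<N. \<Phi> m 0 / fact m) + \<Phi> N t / fact N" by auto
  moreover have "\<Phi> N t = 0" by (simp add: \<Phi>_def nilpotent)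
  moreover have "\<Phi> 0 1 = Y (\<gamma> 1) f"
  proof -
    have "\<gamma> (- 1) \<otimes> \<gamma> 1 = \<one>"
      using generates_add[OF Z(2), of "- 1" 1] generates_zero[OF Z(2)] by simp
    then show ?thesis by (simp add: \<Phi>_def h_def m_assoc)
  qed
  moreover have "\<Phi> m 0 = right_invariant_vf G A ((lie_bracket Z ^^ m) Y) (\<gamma> 1) f" for m
    using True by (simp add: \<Phi>_def h_def right_invariant_vf_apply generates_zero[OF Z(2)])
  ultimately show ?thesis by simp
next
  case False
  then show ?thesis
    using lie_algebra_not_smooth[OF Y(1)[of 0], of f] by (simp add: right_invariant_vf_apply)
qed

end


section \<open>Algebra of the Lie bracket\<close>

lemma sum_vfield_apply: "(\<Sum>i\<in>I. F i) p f = (\<Sum>i\<in>I. F i p f)"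
  for F :: "'i \<Rightarrow> 'm vfield"
  by (induction I rule: infinite_finite_induct) auto

lemma lie_bracket_antisym: "lie_bracket Y C = - lie_bracket C Y"
  by (simp add: lie_bracket_def fun_eq_iff)

context smooth_group
begin

lemma lie_algebra_zero: "Y \<in> lie_algebra G A \<Longrightarrow> Y q (\<lambda>_. 0) = 0"
  using lie_algebra_scale[OF _ smooth_map_const, of Y q 0 0] by simp

lemma lie_algebra_diff:
  assumes "Y \<in> lie_algebra G A" "smooth_fun A f" "smooth_fun A g"
  shows "Y q (\<lambda>r. f r - g r) = Y q f - Y q g"
  using lie_algebra_add[OF assms(1,2) smooth_fun_scale[OF assms(3), of "- 1"]]
    lie_algebra_scale[OF assms(1,3), of q "- 1"] by simp

lemma lie_bracket_add_left:
  assumes "Y \<in> lie_algebra G A" "Y' \<in> lie_algebra G A" "C \<in> lie_algebra G A"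
  shows "lie_bracket (Y + Y') C = lie_bracket Y C + lie_bracket Y' C"
proof (intro ext)
  fix p f
  show "lie_bracket (Y + Y') C p f = (lie_bracket Y C + lie_bracket Y' C) p f"
  proof (cases "smooth_fun A f")
    case True
    then show ?thesis
      using lie_algebra_add[OF assms(3) lie_algebra_smooth[OF assms(1)] lie_algebra_smooth[OF assms(2)]]
      by (simp add: lie_bracket_def)
  next
    case False
    then show ?thesis
      using assms by (simp add: lie_bracket_def lie_algebra_not_smooth lie_algebra_zero)
  qed
qed

lemma lie_bracket_scale_left:
  assumes "Y \<in> lie_algebra G A" "C \<in> lie_algebra G A"
  shows "lie_bracket (r *\<^sub>v Y) C = r *\<^sub>v lie_bracket Y C"
proof (intro ext)
  fix p f
  show "lie_bracket (r *\<^sub>v Y) C p f = (r *\<^sub>v lie_bracket Y C) p f"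
  proof (cases "smooth_fun A f")
    case True
    then show ?thesis
      using lie_algebra_scale[OF assms(2) lie_algebra_smooth[OF assms(1)]]
      by (simp add: lie_bracket_def vf_scale_def right_diff_distrib)
  next
    case False
    then show ?thesis
      using assms by (simp add: lie_bracket_def vf_scale_def lie_algebra_not_smooth lie_algebra_zero)
  qed
qed

lemma lie_bracket_zero_left:
  assumes "C \<in> lie_algebra G A"
  shows "lie_bracket 0 C = 0"
  using assms by (simp add: lie_bracket_def lie_algebra_zero fun_eq_iff)

lemma lie_bracket_Jacobi:
  assumes "a \<in> lie_algebra G A" "b \<in> lie_algebra G A" "c \<in> lie_algebra G A"
  shows "lie_bracket (lie_bracket a b) c = lie_bracket a (lie_bracket b c) - lie_bracket b (lie_bracket a c)"
proof (intro ext)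
  fix p f
  show "lie_bracket (lie_bracket a b) c p f =
      (lie_bracket a (lie_bracket b c) - lie_bracket b (lie_bracket a c)) p f"
  proof (cases "smooth_fun A f")
    case True
    note sm = assms[THEN lie_algebra_smooth, OF True]
    note ab = lie_algebra_smooth[OF assms(1) sm(2)] and ba = lie_algebra_smooth[OF assms(2) sm(1)]
    note bc = lie_algebra_smooth[OF assms(2) sm(3)] and cb = lie_algebra_smooth[OF assms(3) sm(2)]
    note ac = lie_algebra_smooth[OF assms(1) sm(3)] and ca = lie_algebra_smooth[OF assms(3) sm(1)]
    show ?thesis
      by (simp add: lie_bracket_def lie_algebra_diff[OF assms(1) bc cb]
          lie_algebra_diff[OF assms(2) ac ca] lie_algebra_diff[OF assms(3) ab ba])
  next
    case False
    then show ?thesis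
      using assms by (simp add: lie_bracket_def lie_algebra_not_smooth lie_algebra_zero)
  qed
qed

end

section \<open>The grading and the bracket\<close>

locale stratified_lie_group = smooth_group G A
  for G :: "'g::{t2_space,second_countable_topology} monoid" (structure)
    and A :: "('g, 'e::euclidean_space) atlas" +
  fixes s :: nat and V :: "nat \<Rightarrow> 'g vfield set"
  assumes strat: "stratification (lie_algebra G A) s V"
begin

abbreviation \<gg> :: "'g vfield set" where "\<gg> \<equiv> lie_algebra G A"

lemma subspace_layer: "i \<in> {1..s} \<Longrightarrow> vf.subspace (V i)"
  using strat unfolding stratification_def by simp

lemma lie_algebra_eq: "\<gg> = {\<Sum>i=1..s. Y i | Y. \<forall>i\<in>{1..s}. Y i \<in> V i}"
  using strat unfolding stratification_def by (elim conjE)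

lemma bracket_layer_Suc: "i \<in> {1..<s} \<Longrightarrow> V (i + 1) = bracket_space (V 1) (V i)"
  using strat unfolding stratification_def by simp

lemma bracket_last_layer: "bracket_space (V 1) (V s) = {0}"
  using strat unfolding stratification_def by simp

lemma subspace_lie_algebra: "vf.subspace \<gg>"
proof (rule vf.subspaceI)
  show "0 \<in> \<gg>"
    unfolding lie_algebra_eq using vf.subspace_0[OF subspace_layer]
    by (auto intro!: exI[of _ "\<lambda>_. 0"])
next
  fix Y Y' assume "Y \<in> \<gg>" "Y' \<in> \<gg>"
  then obtain F F' where F: "Y = (\<Sum>i=1..s. F i)" "\<forall>i\<in>{1..s}. F i \<in> V i"
    "Y' = (\<Sum>i=1..s. F' i)" "\<forall>i\<in>{1..s}. F' i \<in> V i"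
    unfolding lie_algebra_eq by blast
  then show "Y + Y' \<in> \<gg>"
    unfolding lie_algebra_eq using vf.subspace_add[OF subspace_layer]
    by (auto simp: sum.distrib intro!: exI[of _ "\<lambda>i. F i + F' i"])
next
  fix r Y assume "Y \<in> \<gg>"
  then obtain F where F: "Y = (\<Sum>i=1..s. F i)" "\<forall>i\<in>{1..s}. F i \<in> V i"
    unfolding lie_algebra_eq by blast
  then show "r *\<^sub>v Y \<in> \<gg>"
    unfolding lie_algebra_eq using vf.subspace_scale[OF subspace_layer]
    by (auto simp: vf.scale_sum_right intro!: exI[of _ "\<lambda>i. r *\<^sub>v F i"])
qed

lemma layer_subset: "i \<in> {1..s} \<Longrightarrow> Y \<in> V i \<Longrightarrow> Y \<in> \<gg>"
  unfolding lie_algebra_eq using vf.subspace_0[OF subspace_layer]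
  by (auto intro!: exI[of _ "\<lambda>j. if j = i then Y else 0"])

lemma lie_bracket_sum_left:
  assumes "C \<in> \<gg>" "\<And>i. i \<in> I \<Longrightarrow> Y i \<in> \<gg>"
  shows "lie_bracket (\<Sum>i\<in>I. Y i) C = (\<Sum>i\<in>I. lie_bracket (Y i) C)"
  using assms(2)
proof (induction I rule: infinite_finite_induct)
  case (insert i I)
  have "(\<Sum>i\<in>I. Y i) \<in> \<gg>" using insert.prems by (intro vf.subspace_sum[OF subspace_lie_algebra]) simp
  then have "lie_bracket (Y i + (\<Sum>i\<in>I. Y i)) C = lie_bracket (Y i) C + lie_bracket (\<Sum>i\<in>I. Y i) C"
    using insert.prems assms(1) by (intro lie_bracket_add_left) simp_all
  with insert show ?case by (simp only: sum.insert insert_iff simp_thms)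
qed (simp_all add: lie_bracket_zero_left[OF assms(1)])

lemma lie_bracket_sum_right:
  assumes "C \<in> \<gg>" "\<And>i. i \<in> I \<Longrightarrow> Y i \<in> \<gg>"
  shows "lie_bracket C (\<Sum>i\<in>I. Y i) = (\<Sum>i\<in>I. lie_bracket C (Y i))"
  by (simp only: lie_bracket_antisym[of C] lie_bracket_sum_left[OF assms] sum_negf)

lemma lie_bracket_scale_right:
  assumes "C \<in> \<gg>" "Y \<in> \<gg>"
  shows "lie_bracket C (r *\<^sub>v Y) = r *\<^sub>v lie_bracket C Y"
  by (simp only: lie_bracket_antisym[of C] lie_bracket_scale_left[OF assms(2,1)] vf.scale_minus_right)

text \<open>Reading \<open>V m\<close> as \<open>{0}\<close> beyond the step lets one statement cover both
  \<open>[V i, V j] \<subseteq> V (i + j)\<close> and the vanishing of the bracket for \<open>i + j > s\<close>.\<close>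

definition layer_or_zero :: "nat \<Rightarrow> 'g vfield set" where
  "layer_or_zero m = (if m \<le> s then V m else {0})"

lemma subspace_layer_or_zero: "m \<ge> 1 \<Longrightarrow> vf.subspace (layer_or_zero m)"
  using subspace_layer by (simp add: layer_or_zero_def vf.subspace_def)

lemma layer_or_zero_subset: "m \<ge> 1 \<Longrightarrow> Y \<in> layer_or_zero m \<Longrightarrow> Y \<in> \<gg>"
  using layer_subset vf.subspace_0[OF subspace_lie_algebra] by (auto simp: layer_or_zero_def split: if_splits)

lemma lie_bracket_first_layer:
  assumes j: "1 \<le> j" and Y: "Y \<in> V 1" and C: "C \<in> layer_or_zero j"
  shows "lie_bracket Y C \<in> layer_or_zero (Suc j)"
proof (cases "j \<le> s")
  case True
  then have "lie_bracket Y C \<in> bracket_space (V 1) (V j)"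
    unfolding bracket_space_def using Y C by (intro vf.span_base) (auto simp: layer_or_zero_def)
  then show ?thesis
    using bracket_layer_Suc[of j] bracket_last_layer True j
    by (cases "j = s") (auto simp: layer_or_zero_def)
next
  case False
  then have "C = 0" using C by (simp add: layer_or_zero_def)
  moreover have "Y \<in> \<gg>" using Y layer_subset[of 1] strat by (simp add: stratification_def)
  ultimately have "lie_bracket Y C = 0"
    using lie_bracket_antisym[of Y C] lie_bracket_zero_left by simp
  then show ?thesis using False by (simp add: layer_or_zero_def)
qed

text \<open>The stratification prescribes brackets with \<open>V 1\<close> alone. Since \<open>V (i + 1)\<close> is spanned by brackets
  \<open>[a, b]\<close> with \<open>a \<in> V 1\<close> and \<open>b \<in> V i\<close>, the Jacobi identity
  \<open>[[a, b], C] = [a, [b, C]] - [b, [a, C]]\<close> reduces the case \<open>i + 1\<close> to brackets with \<open>V 1\<close> and with \<open>V i\<close>.\<close>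

lemma lie_bracket_layer:
  "1 \<le> i \<Longrightarrow> i \<le> s \<Longrightarrow> 1 \<le> j \<Longrightarrow> Y \<in> V i \<Longrightarrow> C \<in> layer_or_zero j \<Longrightarrow> lie_bracket Y C \<in> layer_or_zero (i + j)"
proof (induction i arbitrary: j Y C rule: nat_induct_at_least)
  case base
  then show ?case using lie_bracket_first_layer by simp
next
  case (Suc i)
  have C: "C \<in> \<gg>" using Suc.prems layer_or_zero_subset by simp
  have "1 \<le> s" using Suc by simp
  let ?T = "{Y \<in> \<gg>. lie_bracket Y C \<in> layer_or_zero (Suc i + j)}"
  have sub: "vf.subspace (layer_or_zero (Suc i + j))" by (rule subspace_layer_or_zero) simp
  have T: "vf.subspace ?T"
    using vf.subspace_0[OF subspace_lie_algebra] vf.subspace_0[OF sub]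
      vf.subspace_add[OF subspace_lie_algebra] vf.subspace_add[OF sub]
      vf.subspace_scale[OF subspace_lie_algebra] vf.subspace_scale[OF sub] C
    by (intro vf.subspaceI)
      (simp_all add: lie_bracket_zero_left lie_bracket_add_left lie_bracket_scale_left)
  have "lie_bracket a b \<in> ?T" if a: "a \<in> V 1" and b: "b \<in> V i" for a b
  proof -
    have ab: "a \<in> \<gg>" "b \<in> \<gg>"
      using a b layer_subset[of 1 a] layer_subset[of i b] Suc.hyps Suc.prems by simp_all
    have "lie_bracket a b \<in> V (Suc i)"
      using bracket_layer_Suc[of i] a b Suc.hyps Suc.prems
      unfolding bracket_space_def by (auto intro: vf.span_base)
    then have "lie_bracket a b \<in> \<gg>" using layer_subset[of "Suc i"] Suc.prems by simp
    moreover have "lie_bracket a (lie_bracket b C) \<in> layer_or_zero (Suc i + j)"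
      using lie_bracket_first_layer[OF _ a Suc.IH[of j b C]] b Suc.prems by simp
    moreover have "lie_bracket b (lie_bracket a C) \<in> layer_or_zero (Suc i + j)"
      using Suc.IH[OF _ _ b lie_bracket_first_layer[OF _ a Suc.prems(4)]] Suc.prems by simp
    ultimately show ?thesis
      using lie_bracket_Jacobi[OF ab C] vf.subspace_diff[OF sub] by simp
  qed
  then have "{lie_bracket a b | a b. a \<in> V 1 \<and> b \<in> V i} \<subseteq> ?T" by blast
  then have "V (Suc i) \<subseteq> ?T"
    using bracket_layer_Suc[of i] Suc.hyps Suc.prems vf.span_minimal[OF _ T]
    unfolding bracket_space_def by simp
  then show ?case using Suc.prems by blast
qed

end


section \<open>Iterated brackets in an adapted basis\<close>

lemma sum_PiE_Suc:
  fixes g :: "(nat \<Rightarrow> 'b) \<Rightarrow> 'c::comm_monoid_add"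
  shows "(\<Sum>f\<in>PiE {1..Suc k} B. g f) = (\<Sum>f\<in>PiE {1..k} B. \<Sum>y\<in>B (Suc k). g (f(Suc k := y)))"
proof -
  have inj: "inj_on (\<lambda>(y, f). f(Suc k := y)) (B (Suc k) \<times> PiE {1..k} B)"
    by (rule inj_combinator) simp
  have "{1..Suc k} = insert (Suc k) {1..k}" by auto
  then have "(\<Sum>f\<in>PiE {1..Suc k} B. g f) =
      (\<Sum>z\<in>B (Suc k) \<times> PiE {1..k} B. g (case z of (y, f) \<Rightarrow> f(Suc k := y)))"
    by (simp only: PiE_insert_eq sum.reindex[OF inj] o_def)
  also have "\<dots> = (\<Sum>y\<in>B (Suc k). \<Sum>f\<in>PiE {1..k} B. g (f(Suc k := y)))"
    by (simp add: sum.cartesian_product split_def)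
  finally show ?thesis by (simp only: sum.swap[of _ "B (Suc k)"])
qed

text \<open>The multi-degrees \<open>(i\<^sub>1, \<dots>, i\<^sub>k)\<close> that can contribute to a \<open>k\<close>-fold bracket with a field of degree
  \<open>s - d\<close>.\<close>

definition bounded_degrees :: "nat \<Rightarrow> nat \<Rightarrow> nat \<Rightarrow> (nat \<Rightarrow> nat) set" where
  "bounded_degrees s d k = {i \<in> {1..k} \<rightarrow>\<^sub>E {1..s}. (\<Sum>j=1..k. i j) \<le> d}"

text \<open>The last degree ranges over what the bound leaves; for \<open>d \<le> s\<close> it is then automatically at most \<open>s\<close>.\<close>

lemma sum_bounded_degrees_Suc:
  fixes g :: "(nat \<Rightarrow> nat) \<Rightarrow> 'c::comm_monoid_add"
  assumes "d \<le> s"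
  shows "(\<Sum>i\<in>bounded_degrees s d (Suc k). g i) =
    (\<Sum>i\<in>bounded_degrees s d k. \<Sum>l=1..d - (\<Sum>j=1..k. i j). g (i(Suc k := l)))"
proof -
  have fin: "finite ({1..k} \<rightarrow>\<^sub>E {1..s})" for k :: nat by (intro finite_PiE) auto
  have upd: "(\<Sum>j=1..Suc k. (i(Suc k := l)) j) = (\<Sum>j=1..k. i j) + l" for i :: "nat \<Rightarrow> nat" and l
    by simp
  have inner: "(\<Sum>l=1..s. if (\<Sum>j=1..k. i j) + l \<le> d then g (i(Suc k := l)) else 0) =
      (if (\<Sum>j=1..k. i j) \<le> d then (\<Sum>l=1..d - (\<Sum>j=1..k. i j). g (i(Suc k := l))) else 0)" for i
  proof -
    have "{l \<in> {1..s}. (\<Sum>j=1..k. i j) + l \<le> d} =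
        (if (\<Sum>j=1..k. i j) \<le> d then {1..d - (\<Sum>j=1..k. i j)} else {})"
      using assms by auto
    then show ?thesis by (simp only: sum.inter_filter[symmetric] finite_atLeastAtMost) simp
  qed
  have "(\<Sum>i\<in>bounded_degrees s d (Suc k). g i) =
      (\<Sum>i\<in>{1..Suc k} \<rightarrow>\<^sub>E {1..s}. if (\<Sum>j=1..Suc k. i j) \<le> d then g i else 0)"
    unfolding bounded_degrees_def by (rule sum.inter_filter[OF fin])
  also have "\<dots> = (\<Sum>i\<in>{1..k} \<rightarrow>\<^sub>E {1..s}. \<Sum>l=1..s.
      if (\<Sum>j=1..k. i j) + l \<le> d then g (i(Suc k := l)) else 0)"
    by (simp only: sum_PiE_Suc upd)
  also have "\<dots> = (\<Sum>i\<in>bounded_degrees s d k. \<Sum>l=1..d - (\<Sum>j=1..k. i j). g (i(Suc k := l)))"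
    unfolding bounded_degrees_def by (simp only: inner sum.inter_filter[OF fin])
  finally show ?thesis .
qed

lemma bounded_degrees_empty:
  assumes "k > d"
  shows "bounded_degrees s d k = {}"
proof -
  have "k \<le> (\<Sum>j=1..k. i j)" if "i \<in> {1..k} \<rightarrow>\<^sub>E {1..s}" for i
  proof -
    have "(\<Sum>j=1..k. 1) \<le> (\<Sum>j=1..k. i j)"
      using that by (intro sum_mono) (auto dest: PiE_mem)
    then show ?thesis by simp
  qed
  then have "\<not> (\<Sum>j=1..k. i j) \<le> d" if "i \<in> {1..k} \<rightarrow>\<^sub>E {1..s}" for i
    using assms that le_trans not_le by metis
  then show ?thesis unfolding bounded_degrees_def by blast
qed

locale adapted_lie_group = stratified_lie_group G A s V
  for G :: "'g::{t2_space,second_countable_topology} monoid" (structure)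
    and A :: "('g, 'e::euclidean_space) atlas" and s V +
  fixes n :: "nat \<Rightarrow> nat" and X :: "nat \<Rightarrow> nat \<Rightarrow> 'g vfield"
    and c :: "nat \<Rightarrow> nat \<Rightarrow> nat \<Rightarrow> nat \<Rightarrow> nat \<Rightarrow> real"
  assumes basis: "adapted_basis s V n X" and constants: "structural_constants s n X c"
begin

definition combination :: "(nat \<Rightarrow> nat \<Rightarrow> real) \<Rightarrow> 'g vfield" where
  "combination a = (\<Sum>i=1..s. \<Sum>\<alpha>=1..n i. a i \<alpha> *\<^sub>v X i \<alpha>)"

lemma basis_in_layer: "i \<in> {1..s} \<Longrightarrow> \<alpha> \<in> {1..n i} \<Longrightarrow> X i \<alpha> \<in> V i"
  using basis vf.span_base[of "X i \<alpha>" "X i ` {1..n i}"] unfolding adapted_basis_def by blast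

lemma basis_in_lie_algebra: "i \<in> {1..s} \<Longrightarrow> \<alpha> \<in> {1..n i} \<Longrightarrow> X i \<alpha> \<in> \<gg>"
  using basis_in_layer layer_subset by simp

lemma combination_in_lie_algebra: "combination a \<in> \<gg>"
  unfolding combination_def
  by (intro vf.subspace_sum[OF subspace_lie_algebra] vf.subspace_scale[OF subspace_lie_algebra]
      basis_in_lie_algebra)

lemma lie_algebra_combination:
  assumes "Y \<in> \<gg>"
  obtains a where "Y = combination a"
proof -
  obtain F where F: "Y = (\<Sum>i=1..s. F i)" "\<forall>i\<in>{1..s}. F i \<in> V i"
    using assms unfolding lie_algebra_eq by blast
  have "\<exists>u. F i = (\<Sum>\<alpha>=1..n i. u \<alpha> *\<^sub>v X i \<alpha>)" if "i \<in> {1..s}" for i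
  proof -
    have "inj_on (X i) {1..n i} \<and> vf.span (X i ` {1..n i}) = V i"
      using basis that unfolding adapted_basis_def by blast
    then have inj: "inj_on (X i) {1..n i}" and "F i \<in> vf.span (X i ` {1..n i})"
      using F(2) that by blast+
    then obtain u where "F i = (\<Sum>Y\<in>X i ` {1..n i}. u Y *\<^sub>v Y)"
      by (auto simp: vf.span_finite)
    then have "F i = (\<Sum>\<alpha>=1..n i. (u \<circ> X i) \<alpha> *\<^sub>v X i \<alpha>)"
      by (simp only: sum.reindex[OF inj] o_def)
    then show ?thesis by blast
  qed
  then obtain u where "\<And>i. i \<in> {1..s} \<Longrightarrow> F i = (\<Sum>\<alpha>=1..n i. u i \<alpha> *\<^sub>v X i \<alpha>)" by metis
  then have "Y = combination u" unfolding F(1) combination_def by (intro sum.cong) auto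
  then show thesis by (rule that)
qed

lemma lie_bracket_combination_basis:
  assumes m: "m \<in> {1..s}" and b: "b \<in> {1..n m}"
  shows "lie_bracket (combination a) (X m b) =
    (\<Sum>i=1..s - m. \<Sum>\<alpha>=1..n i. \<Sum>\<gamma>=1..n (m + i). (c i m \<alpha> b \<gamma> * a i \<alpha>) *\<^sub>v X (m + i) \<gamma>)"
proof -
  note sub = subspace_lie_algebra
  have Xm: "X m b \<in> \<gg>" by (rule basis_in_lie_algebra[OF m b])
  have "lie_bracket (combination a) (X m b) =
      (\<Sum>i=1..s. lie_bracket (\<Sum>\<alpha>=1..n i. a i \<alpha> *\<^sub>v X i \<alpha>) (X m b))"
    unfolding combination_def
    by (intro lie_bracket_sum_left[OF Xm] vf.subspace_sum[OF sub] vf.subspace_scale[OF sub]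
        basis_in_lie_algebra)
  also have "\<dots> = (\<Sum>i=1..s. \<Sum>\<alpha>=1..n i. lie_bracket (a i \<alpha> *\<^sub>v X i \<alpha>) (X m b))"
    by (intro sum.cong refl lie_bracket_sum_left[OF Xm] vf.subspace_scale[OF sub]
        basis_in_lie_algebra)
  also have "\<dots> = (\<Sum>i=1..s. \<Sum>\<alpha>=1..n i. a i \<alpha> *\<^sub>v lie_bracket (X i \<alpha>) (X m b))"
    by (intro sum.cong refl lie_bracket_scale_left[OF _ Xm] basis_in_lie_algebra)
  also have "\<dots> = (\<Sum>i=1..s - m. \<Sum>\<alpha>=1..n i. a i \<alpha> *\<^sub>v lie_bracket (X i \<alpha>) (X m b))"
  proof (rule sum.mono_neutral_right)
    show "\<forall>i\<in>{1..s} - {1..s - m}. (\<Sum>\<alpha>=1..n i. a i \<alpha> *\<^sub>v lie_bracket (X i \<alpha>) (X m b)) = 0"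
    proof (intro ballI sum.neutral)
      fix i \<alpha> assume i: "i \<in> {1..s} - {1..s - m}" and \<alpha>: "\<alpha> \<in> {1..n i}"
      have "lie_bracket (X i \<alpha>) (X m b) \<in> layer_or_zero (i + m)"
        using i \<alpha> m b basis_in_layer[of i \<alpha>] basis_in_layer[of m b]
        by (intro lie_bracket_layer) (auto simp: layer_or_zero_def)
      moreover have "i + m > s" using i m by auto
      ultimately show "a i \<alpha> *\<^sub>v lie_bracket (X i \<alpha>) (X m b) = 0" by (simp add: layer_or_zero_def)
    qed
  qed auto
  also have "\<dots> = (\<Sum>i=1..s - m. \<Sum>\<alpha>=1..n i. \<Sum>\<gamma>=1..n (m + i). (c i m \<alpha> b \<gamma> * a i \<alpha>) *\<^sub>v X (m + i) \<gamma>)"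
  proof (intro sum.cong refl)
    fix i \<alpha> assume i: "i \<in> {1..s - m}" and \<alpha>: "\<alpha> \<in> {1..n i}"
    have "lie_bracket (X i \<alpha>) (X m b) = (\<Sum>\<gamma>=1..n (i + m). c i m \<alpha> b \<gamma> *\<^sub>v X (i + m) \<gamma>)"
      using constants i m b \<alpha> unfolding structural_constants_def by auto
    then show "a i \<alpha> *\<^sub>v lie_bracket (X i \<alpha>) (X m b) =
        (\<Sum>\<gamma>=1..n (m + i). (c i m \<alpha> b \<gamma> * a i \<alpha>) *\<^sub>v X (m + i) \<gamma>)"
      by (simp add: vf.scale_sum_right add.commute mult.commute)
  qed
  finally show ?thesis .
qed

text \<open>The contribution of one choice of indices to the \<open>k\<close>-fold bracket of \<open>combination a\<close> with
  \<open>X i\<^sub>0 \<beta>\<^sub>0\<close>. The tuple \<open>\<beta>\<close> is updated at \<open>0\<close> also in the final index, so that \<open>k = 0\<close> gives \<open>X i\<^sub>0 \<beta>\<^sub>0\<close> itself and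
  the induction on \<open>k\<close> can start there.\<close>

definition bracket_term ::
  "(nat \<Rightarrow> nat \<Rightarrow> real) \<Rightarrow> nat \<Rightarrow> nat \<Rightarrow> nat \<Rightarrow> (nat \<Rightarrow> nat) \<Rightarrow> (nat \<Rightarrow> nat) \<Rightarrow> (nat \<Rightarrow> nat) \<Rightarrow> 'g vfield" where
  "bracket_term a i\<^sub>0 \<beta>\<^sub>0 k i \<alpha> \<beta> =
     ((\<Prod>j=1..k. c (i j) (i\<^sub>0 + (\<Sum>m=1..<j. i m)) (\<alpha> j) ((\<beta>(0 := \<beta>\<^sub>0)) (j - 1)) (\<beta> j)) *
      (\<Prod>j=1..k. a (i j) (\<alpha> j))) *\<^sub>v X (i\<^sub>0 + (\<Sum>m=1..k. i m)) ((\<beta>(0 := \<beta>\<^sub>0)) k)"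

lemma bracket_term_Suc:
  "bracket_term a i\<^sub>0 \<beta>\<^sub>0 (Suc k) (i(Suc k := l)) (\<alpha>(Suc k := \<alpha>')) (\<beta>(Suc k := \<gamma>)) =
    ((\<Prod>j=1..k. c (i j) (i\<^sub>0 + (\<Sum>m=1..<j. i m)) (\<alpha> j) ((\<beta>(0 := \<beta>\<^sub>0)) (j - 1)) (\<beta> j)) *
      (\<Prod>j=1..k. a (i j) (\<alpha> j))) *\<^sub>v
    (c l (i\<^sub>0 + (\<Sum>m=1..k. i m)) \<alpha>' ((\<beta>(0 := \<beta>\<^sub>0)) k) \<gamma> * a l \<alpha>') *\<^sub>v
      X (i\<^sub>0 + (\<Sum>m=1..k. i m) + l) \<gamma>"
proof -
  have 1: "(\<Prod>j=1..k. a ((i(Suc k := l)) j) ((\<alpha>(Suc k := \<alpha>')) j)) = (\<Prod>j=1..k. a (i j) (\<alpha> j))"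
    by (intro prod.cong) auto
  have S: "(\<Sum>m=1..<j. (i(Suc k := l)) m) = (\<Sum>m=1..<j. i m)" if "j \<le> Suc k" for j
    using that by (intro sum.cong) auto
  have S': "(\<Sum>m=1..k. (i(Suc k := l)) m) = (\<Sum>m=1..k. i m)"
    by (intro sum.cong) auto
  have 2: "(\<Prod>j=1..k. c ((i(Suc k := l)) j) (i\<^sub>0 + (\<Sum>m=1..<j. (i(Suc k := l)) m)) ((\<alpha>(Suc k := \<alpha>')) j)
      ((\<beta>(Suc k := \<gamma>, 0 := \<beta>\<^sub>0)) (j - 1)) ((\<beta>(Suc k := \<gamma>)) j)) =
    (\<Prod>j=1..k. c (i j) (i\<^sub>0 + (\<Sum>m=1..<j. i m)) (\<alpha> j) ((\<beta>(0 := \<beta>\<^sub>0)) (j - 1)) (\<beta> j))"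
    by (intro prod.cong) (auto simp: S)
  have "{1..<Suc k} = {1..k}" by auto
  then show ?thesis
    unfolding bracket_term_def using 1 2 S' S[of "Suc k"]
    by (simp add: mult_ac add_ac)
qed

text \<open>Induction on \<open>k\<close>: another bracket with \<open>combination a\<close> multiplies each term by a structural constant
  and a coefficient and appends one entry to each of the three index tuples. The bracket vanishes by the grading as soon as
  the total degree exceeds \<open>s\<close>, which is the bound on the degrees. The new sums, which come out innermost, have to be
  moved next to the sums over the tuples that they extend.\<close>

lemma iterated_bracket_expansion:
  assumes i0: "i\<^sub>0 \<in> {1..s}" and b0: "\<beta>\<^sub>0 \<in> {1..n i\<^sub>0}"
  shows "(lie_bracket (combination a) ^^ k) (X i\<^sub>0 \<beta>\<^sub>0) =
    (\<Sum>i\<in>bounded_degrees s (s - i\<^sub>0) k.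
       \<Sum>\<alpha>\<in>(\<Pi>\<^sub>E j\<in>{1..k}. {1..n (i j)}).
       \<Sum>\<beta>\<in>(\<Pi>\<^sub>E j\<in>{1..k}. {1..n (i\<^sub>0 + (\<Sum>m=1..j. i m))}). bracket_term a i\<^sub>0 \<beta>\<^sub>0 k i \<alpha> \<beta>)"
proof (induction k)
  case 0
  show ?case by (simp add: bounded_degrees_def bracket_term_def)
next
  case (Suc k)
  let ?ad = "lie_bracket (combination a)"
  let ?A = "\<lambda>k i. \<Pi>\<^sub>E j\<in>{1..k}. {1..n (i j)}"
  let ?B = "\<lambda>k i. \<Pi>\<^sub>E j\<in>{1..k}. {1..n (i\<^sub>0 + (\<Sum>m=1..j. i m))}"
  let ?T = "bracket_term a i\<^sub>0 \<beta>\<^sub>0"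
  let ?I = "bounded_degrees s (s - i\<^sub>0)"
  let ?S = "\<lambda>i. \<Sum>m=1..k. i m"
  note sub = subspace_lie_algebra
  have last: "i\<^sub>0 + ?S i \<in> {1..s} \<and> (\<beta>(0 := \<beta>\<^sub>0)) k \<in> {1..n (i\<^sub>0 + ?S i)}"
    if "i \<in> ?I k" "\<beta> \<in> ?B k i" for i \<beta> :: "nat \<Rightarrow> nat"
  proof (cases k)
    case 0
    then show ?thesis using i0 b0 by simp
  next
    case (Suc k')
    then have "\<beta> k \<in> {1..n (i\<^sub>0 + ?S i)}" using PiE_mem[OF that(2), of k] by simp
    then show ?thesis using that(1) i0 Suc unfolding bounded_degrees_def by auto
  qed
  have T_mem: "?T k i \<alpha> \<beta> \<in> \<gg>" if "i \<in> ?I k" "\<beta> \<in> ?B k i" for i \<alpha> \<beta>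
    unfolding bracket_term_def using last[OF that]
    by (intro vf.subspace_scale[OF sub] basis_in_lie_algebra) auto
  have ad_T: "?ad (?T k i \<alpha> \<beta>) = (\<Sum>l=1..s - i\<^sub>0 - ?S i. \<Sum>\<alpha>'=1..n l. \<Sum>\<gamma>=1..n (i\<^sub>0 + ?S i + l).
      ?T (Suc k) (i(Suc k := l)) (\<alpha>(Suc k := \<alpha>')) (\<beta>(Suc k := \<gamma>)))"
    if "i \<in> ?I k" "\<beta> \<in> ?B k i" for i \<alpha> \<beta>
    using last[OF that]
    by (simp only: bracket_term_Suc bracket_term_def[of _ _ _ k]
        lie_bracket_scale_right[OF combination_in_lie_algebra basis_in_lie_algebra]
        lie_bracket_combination_basis vf.scale_sum_right diff_diff_left)
  have "(?ad ^^ Suc k) (X i\<^sub>0 \<beta>\<^sub>0) = ?ad (\<Sum>i\<in>?I k. \<Sum>\<alpha>\<in>?A k i. \<Sum>\<beta>\<in>?B k i. ?T k i \<alpha> \<beta>)"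
    by (simp add: Suc.IH)
  also have "\<dots> = (\<Sum>i\<in>?I k. \<Sum>\<alpha>\<in>?A k i. \<Sum>\<beta>\<in>?B k i. ?ad (?T k i \<alpha> \<beta>))"
    by (simp add: lie_bracket_sum_right[OF combination_in_lie_algebra] T_mem vf.subspace_sum[OF sub])
  also have "\<dots> = (\<Sum>i\<in>?I k. \<Sum>\<alpha>\<in>?A k i. \<Sum>\<beta>\<in>?B k i.
      \<Sum>l=1..s - i\<^sub>0 - ?S i. \<Sum>\<alpha>'=1..n l. \<Sum>\<gamma>=1..n (i\<^sub>0 + ?S i + l).
        ?T (Suc k) (i(Suc k := l)) (\<alpha>(Suc k := \<alpha>')) (\<beta>(Suc k := \<gamma>)))"
    by (rule sum.cong[OF refl], rule sum.cong[OF refl], rule sum.cong[OF refl], rule ad_T)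
  also have "\<dots> = (\<Sum>i\<in>?I k. \<Sum>l=1..s - i\<^sub>0 - ?S i. \<Sum>\<alpha>\<in>?A k i. \<Sum>\<alpha>'=1..n l. \<Sum>\<beta>\<in>?B k i.
      \<Sum>\<gamma>=1..n (i\<^sub>0 + ?S i + l).
        ?T (Suc k) (i(Suc k := l)) (\<alpha>(Suc k := \<alpha>')) (\<beta>(Suc k := \<gamma>)))"
    (is "_ = (\<Sum>i\<in>?I k. \<Sum>l=1..s - i\<^sub>0 - ?S i. ?R i l)")
  proof (rule sum.cong[OF refl])
    fix i
    let ?U = "\<lambda>\<alpha> \<beta> l \<alpha>'. \<Sum>\<gamma>=1..n (i\<^sub>0 + ?S i + l).
        ?T (Suc k) (i(Suc k := l)) (\<alpha>(Suc k := \<alpha>')) (\<beta>(Suc k := \<gamma>))"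
    have "(\<Sum>\<beta>\<in>?B k i. \<Sum>l=1..s - i\<^sub>0 - ?S i. \<Sum>\<alpha>'=1..n l. ?U \<alpha> \<beta> l \<alpha>') =
        (\<Sum>l=1..s - i\<^sub>0 - ?S i. \<Sum>\<alpha>'=1..n l. \<Sum>\<beta>\<in>?B k i. ?U \<alpha> \<beta> l \<alpha>')" for \<alpha>
      by (subst sum.swap) (intro sum.cong refl sum.swap)
    then show "(\<Sum>\<alpha>\<in>?A k i. \<Sum>\<beta>\<in>?B k i. \<Sum>l=1..s - i\<^sub>0 - ?S i. \<Sum>\<alpha>'=1..n l. ?U \<alpha> \<beta> l \<alpha>') =
        (\<Sum>l=1..s - i\<^sub>0 - ?S i. \<Sum>\<alpha>\<in>?A k i. \<Sum>\<alpha>'=1..n l. \<Sum>\<beta>\<in>?B k i. ?U \<alpha> \<beta> l \<alpha>')"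
      by (simp only: sum.swap[of _ _ "?A k i"])
  qed
  also have "\<dots> = (\<Sum>i\<in>?I k. \<Sum>l=1..s - i\<^sub>0 - ?S i.
      \<Sum>\<alpha>\<in>?A (Suc k) (i(Suc k := l)). \<Sum>\<beta>\<in>?B (Suc k) (i(Suc k := l)). ?T (Suc k) (i(Suc k := l)) \<alpha> \<beta>)"
  proof (rule sum.cong[OF refl], rule sum.cong[OF refl])
    fix i l
    have A: "?A k (i(Suc k := l)) = ?A k i" by (rule PiE_cong) auto
    have "(\<Sum>m=1..j. (i(Suc k := l)) m) = (\<Sum>m=1..j. i m)" if "j \<in> {1..k}" for j
      using that by (intro sum.cong) auto
    then have B: "?B k (i(Suc k := l)) = ?B k i" by (intro PiE_cong) simp
    have S: "i\<^sub>0 + (\<Sum>m=1..Suc k. (i(Suc k := l)) m) = i\<^sub>0 + ?S i + l" by simp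
    show "?R i l = (\<Sum>\<alpha>\<in>?A (Suc k) (i(Suc k := l)). \<Sum>\<beta>\<in>?B (Suc k) (i(Suc k := l)).
        ?T (Suc k) (i(Suc k := l)) \<alpha> \<beta>)"
      by (simp only: sum_PiE_Suc A B S fun_upd_same)
  qed
  also have "\<dots> = (\<Sum>i\<in>?I (Suc k). \<Sum>\<alpha>\<in>?A (Suc k) i. \<Sum>\<beta>\<in>?B (Suc k) i. ?T (Suc k) i \<alpha> \<beta>)"
    by (rule sum_bounded_degrees_Suc[symmetric]) simp
  finally show ?case .
qed

lemma bracket_combination_in_lie_algebra:
  assumes "Y \<in> \<gg>"
  shows "lie_bracket (combination a) Y \<in> \<gg>"
proof -
  note sub = subspace_lie_algebra and Z = combination_in_lie_algebra
  obtain u where Y: "Y = combination u" using lie_algebra_combination[OF assms] .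
  have "lie_bracket (combination a) (X m b) \<in> \<gg>" if "m \<in> {1..s}" "b \<in> {1..n m}" for m b
    unfolding lie_bracket_combination_basis[OF that] using that
    by (intro vf.subspace_sum[OF sub] vf.subspace_scale[OF sub] basis_in_lie_algebra) auto
  then have "(\<Sum>m=1..s. \<Sum>b=1..n m. u m b *\<^sub>v lie_bracket (combination a) (X m b)) \<in> \<gg>"
    by (intro vf.subspace_sum[OF sub] vf.subspace_scale[OF sub])
  also have "(\<Sum>m=1..s. \<Sum>b=1..n m. u m b *\<^sub>v lie_bracket (combination a) (X m b)) =
      (\<Sum>m=1..s. \<Sum>b=1..n m. lie_bracket (combination a) (u m b *\<^sub>v X m b))"
    by (intro sum.cong refl lie_bracket_scale_right[OF Z, symmetric] basis_in_lie_algebra)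
  also have "\<dots> = (\<Sum>m=1..s. lie_bracket (combination a) (\<Sum>b=1..n m. u m b *\<^sub>v X m b))"
    by (intro sum.cong refl lie_bracket_sum_right[OF Z, symmetric] vf.subspace_scale[OF sub]
        basis_in_lie_algebra)
  also have "\<dots> = lie_bracket (combination a) Y"
    unfolding Y combination_def[of u]
    by (intro lie_bracket_sum_right[OF Z, symmetric] vf.subspace_sum[OF sub]
        vf.subspace_scale[OF sub] basis_in_lie_algebra)
  finally show ?thesis .
qed

lemma iterated_bracket_in_lie_algebra:
  "Y \<in> \<gg> \<Longrightarrow> (lie_bracket (combination a) ^^ k) Y \<in> \<gg>"
  by (induction k) (simp_all add: bracket_combination_in_lie_algebra)

lemma iterated_bracket_nilpotent:
  assumes "i\<^sub>0 \<in> {1..s}" "\<beta>\<^sub>0 \<in> {1..n i\<^sub>0}" "k > s - i\<^sub>0"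
  shows "(lie_bracket (combination a) ^^ k) (X i\<^sub>0 \<beta>\<^sub>0) = 0"
  using iterated_bracket_expansion[OF assms(1,2)] bounded_degrees_empty[OF assms(3)] by simp

end


section \<open>The exponential map and the conclusion\<close>

context adapted_lie_group
begin

lemma lie_exp_eq: "lie_exp G A Y = (SOME p. \<exists>\<gamma>. generates \<gamma> Y \<and> p = \<gamma> 1)"
  unfolding lie_exp_def generates_def conj_assoc ..

lemma combination_apply: "combination a p f = (\<Sum>i=1..s. \<Sum>\<alpha>=1..n i. a i \<alpha> * X i \<alpha> p f)"
  unfolding combination_def by (simp add: sum_vfield_apply vf_scale_def)

lemma generates_half:
  assumes "generates \<gamma> (combination (\<lambda>i \<alpha>. 2 * a i \<alpha>))"
  shows "generates (\<lambda>t. \<gamma> (t / 2)) (combination a)"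
  unfolding generates_def one_parameter_subgroup_def
proof (intro conjI allI impI)
  show "smooth_map std_atlas A (\<lambda>t. \<gamma> (t / 2))"
    by (rule smooth_map_compose[OF std_atlas_charts std_atlas_charts(1) _
          smooth_map_bounded_linear[OF bounded_linear_divide] generates_smooth[OF assms] chart_open])
      (simp_all add: std_atlas_def)
  show "\<gamma> ((t + u) / 2) = \<gamma> (t / 2) \<otimes> \<gamma> (u / 2)" for t u
    by (simp add: add_divide_distrib generates_add[OF assms])
  fix f assume "smooth_fun A f"
  then have "((\<lambda>t. f (\<gamma> t)) has_real_derivative combination (\<lambda>i \<alpha>. 2 * a i \<alpha>) \<one> f) (at (0 / 2))"
    using assms unfolding generates_def by simp
  then have "((\<lambda>t. f (\<gamma> (t / 2))) has_real_derivative
      combination (\<lambda>i \<alpha>. 2 * a i \<alpha>) \<one> f * (1 / 2)) (at 0)"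
    by (rule DERIV_chain2) (auto intro!: derivative_eq_intros)
  moreover have "combination (\<lambda>i \<alpha>. 2 * a i \<alpha>) \<one> f = 2 * combination a \<one> f"
    by (simp add: combination_apply sum_distrib_left mult.assoc)
  ultimately show "((\<lambda>t. f (\<gamma> (t / 2))) has_real_derivative combination a \<one> f) (at 0)" by simp
qed

lemma generates_trivial: "generates (\<lambda>_. \<one>) 0"
  unfolding generates_def one_parameter_subgroup_def by (simp add: smooth_map_const)

lemma graded_coordinates_iff:
  assumes "graded_coordinates G A s n X x"
  shows "p = lie_exp G A (combination a) \<longleftrightarrow> (\<forall>i\<in>{1..s}. \<forall>\<alpha>\<in>{1..n i}. a i \<alpha> = x i \<alpha> p)"
  using assms[unfolded graded_coordinates_def, rule_format] unfolding combination_def .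

text \<open>Existence of one-parameter subgroups follows from the injectivity of the exponential map that
  graded coordinates express. If \<open>Z\<close> had none, then \<open>2 Z\<close> would have none either. For both fields \<open>lie_exp\<close> would then be the
  choice of an element from the same empty set, hence the same element, and injectivity would give
  \<open>2 Z = Z\<close>. But \<open>Z = 0\<close> generates the constant subgroup.\<close>

lemma generator_exists:
  assumes gc: "graded_coordinates G A s n X x"
  shows "\<exists>\<gamma>. generates \<gamma> (combination a)"
proof (rule ccontr)
  assume none: "\<not> (\<exists>\<gamma>. generates \<gamma> (combination a))"
  let ?b = "\<lambda>i \<alpha>. 2 * a i \<alpha>"
  have none2: "\<not> (\<exists>\<gamma>. generates \<gamma> (combination ?b))"
    using none generates_half by blast
  define p where "p = lie_exp G A (combination a)"
  have "p = lie_exp G A (combination ?b)"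
    unfolding p_def lie_exp_eq using none none2 by simp
  then have "\<forall>i\<in>{1..s}. \<forall>\<alpha>\<in>{1..n i}. ?b i \<alpha> = x i \<alpha> p"
    unfolding graded_coordinates_iff[OF gc] .
  moreover have "\<forall>i\<in>{1..s}. \<forall>\<alpha>\<in>{1..n i}. a i \<alpha> = x i \<alpha> p"
    using p_def unfolding graded_coordinates_iff[OF gc] .
  ultimately have "\<forall>i\<in>{1..s}. \<forall>\<alpha>\<in>{1..n i}. a i \<alpha> = 0" by fastforce
  then have "combination a = 0" by (simp add: fun_eq_iff combination_apply)
  then show False using none generates_trivial by auto
qed

lemma generator_through_point:
  assumes gc: "graded_coordinates G A s n X x"
  obtains \<gamma> where "generates \<gamma> (combination (\<lambda>i \<alpha>. x i \<alpha> p))" "\<gamma> 1 = p"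
proof -
  let ?Z = "combination (\<lambda>i \<alpha>. x i \<alpha> p)"
  have "p = lie_exp G A ?Z"
    unfolding graded_coordinates_iff[OF gc] by simp
  moreover have "\<exists>\<gamma>. generates \<gamma> ?Z \<and> lie_exp G A ?Z = \<gamma> 1"
  proof -
    obtain \<gamma> where "generates \<gamma> ?Z" using generator_exists[OF gc] ..
    then have "\<exists>\<gamma>'. generates \<gamma>' ?Z \<and> \<gamma> 1 = \<gamma>' 1" by (intro exI[of _ \<gamma>]) simp
    then show ?thesis unfolding lie_exp_eq by (rule someI)
  qed
  ultimately have "\<exists>\<gamma>. generates \<gamma> ?Z \<and> p = \<gamma> 1" by simp
  then show thesis using that by blast
qed

lemma right_invariant_vf_sum:
  "right_invariant_vf G A (\<Sum>i\<in>I. F i) p f = (\<Sum>i\<in>I. right_invariant_vf G A (F i) p f)"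
  by (simp add: right_invariant_vf_apply sum_vfield_apply)

lemma right_invariant_vf_scale:
  "right_invariant_vf G A (r *\<^sub>v Y) p f = r * right_invariant_vf G A Y p f"
  by (simp add: right_invariant_vf_apply vf_scale_def)

text \<open>At a point \<open>p\<close> the expansion is applied to the field \<open>Z\<close> whose coefficients are the coordinates of \<open>p\<close>
  itself, so that \<open>exp Z = p\<close>. The field \<open>Z\<close> changes with \<open>p\<close>, which is how constant coefficients of the iterated
  brackets become the polynomial coefficients of the formula.\<close>

lemma left_invariant_eq_right_invariant_expansion:
  assumes gc: "graded_coordinates G A s n X x" and i0: "i\<^sub>0 \<in> {1..s}" and b0: "\<beta>\<^sub>0 \<in> {1..n i\<^sub>0}"
  shows "X i\<^sub>0 \<beta>\<^sub>0 =
    right_invariant_vf G A (X i\<^sub>0 \<beta>\<^sub>0) +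
    (\<Sum>k=1..s - i\<^sub>0. (1 / fact k) *\<^sub>v
      (\<Sum>i\<in>{i \<in> {1..k} \<rightarrow>\<^sub>E {1..s}. (\<Sum>j=1..k. i j) \<le> s - i\<^sub>0}.
       \<Sum>\<alpha>\<in>(\<Pi>\<^sub>E j\<in>{1..k}. {1..n (i j)}).
       \<Sum>\<beta>\<in>(\<Pi>\<^sub>E j\<in>{1..k}. {1..n (i\<^sub>0 + (\<Sum>m=1..j. i m))}).
         (\<lambda>p. (\<Prod>j=1..k. c (i j) (i\<^sub>0 + (\<Sum>m=1..<j. i m)) (\<alpha> j) ((\<beta>(0 := \<beta>\<^sub>0)) (j - 1)) (\<beta> j)) *
              (\<Prod>j=1..k. x (i j) (\<alpha> j) p))
         \<cdot>\<^sub>v right_invariant_vf G A (X (i\<^sub>0 + (\<Sum>m=1..k. i m)) (\<beta> k))))" (is "_ = ?rhs")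
proof (intro ext)
  fix p f
  let ?Z = "combination (\<lambda>i \<alpha>. x i \<alpha> p)"
  let ?Y = "\<lambda>k. (lie_bracket ?Z ^^ k) (X i\<^sub>0 \<beta>\<^sub>0)"
  have Y: "?Y k \<in> \<gg>" for k
    by (rule iterated_bracket_in_lie_algebra[OF basis_in_lie_algebra[OF i0 b0]])
  have gen: "\<exists>\<eta>. generates \<eta> (?Y k)" for k
    using lie_algebra_combination[OF Y] generator_exists[OF gc] by metis
  \<comment> \<open>A \<open>k\<close>-fold bracket raises the degree by at least \<open>k\<close>, so it is zero for \<open>k > s - i\<^sub>0\<close>.\<close>
  have nil: "?Y (Suc (s - i\<^sub>0)) = 0"
    by (rule iterated_bracket_nilpotent[OF i0 b0]) simp
  obtain \<gamma> where \<gamma>: "generates \<gamma> ?Z" "\<gamma> 1 = p" by (rule generator_through_point[OF gc])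
  have summand: "right_invariant_vf G A (?Y k) p f =
      (\<Sum>i\<in>bounded_degrees s (s - i\<^sub>0) k.
       \<Sum>\<alpha>\<in>(\<Pi>\<^sub>E j\<in>{1..k}. {1..n (i j)}).
       \<Sum>\<beta>\<in>(\<Pi>\<^sub>E j\<in>{1..k}. {1..n (i\<^sub>0 + (\<Sum>m=1..j. i m))}).
         (\<Prod>j=1..k. c (i j) (i\<^sub>0 + (\<Sum>m=1..<j. i m)) (\<alpha> j) ((\<beta>(0 := \<beta>\<^sub>0)) (j - 1)) (\<beta> j)) *
         (\<Prod>j=1..k. x (i j) (\<alpha> j) p) *
         right_invariant_vf G A (X (i\<^sub>0 + (\<Sum>m=1..k. i m)) (\<beta> k)) p f)" if "k \<in> {1..s - i\<^sub>0}" for k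
    using that
    by (simp add: iterated_bracket_expansion[OF i0 b0] bracket_term_def
        right_invariant_vf_sum right_invariant_vf_scale)
  have "{..<Suc (s - i\<^sub>0)} = insert 0 {1..s - i\<^sub>0}" by auto
  then have "X i\<^sub>0 \<beta>\<^sub>0 p f = right_invariant_vf G A (X i\<^sub>0 \<beta>\<^sub>0) p f +
      (\<Sum>k=1..s - i\<^sub>0. 1 / fact k * right_invariant_vf G A (?Y k) p f)"
    using left_invariant_eq_exp_ad_right_invariant[OF combination_in_lie_algebra \<gamma>(1) Y gen nil, of f]
    by (simp add: \<gamma>(2))
  also have "\<dots> = ?rhs p f"
    by (simp only: plus_fun_apply sum_vfield_apply vf_scale_def vf_mult_def
        summand[unfolded bounded_degrees_def] cong: sum.cong)
  finally show "X i\<^sub>0 \<beta>\<^sub>0 p f = ?rhs p f" .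
qed

end

theorem theorem3p2:
  fixes G :: "'g::{t2_space,second_countable_topology} monoid"
    and A :: "('g, 'e::euclidean_space) atlas"
    and s :: nat
    and V :: "nat \<Rightarrow> 'g vfield set"
    and n :: "nat \<Rightarrow> nat"
    and X :: "nat \<Rightarrow> nat \<Rightarrow> 'g vfield"
    and c :: "nat \<Rightarrow> nat \<Rightarrow> nat \<Rightarrow> nat \<Rightarrow> nat \<Rightarrow> real"
    and x :: "nat \<Rightarrow> nat \<Rightarrow> 'g \<Rightarrow> real"
  assumes "stratified_group G A s V"
    and "adapted_basis s V n X"
    and "structural_constants s n X c"
    and "graded_coordinates G A s n X x"
  shows "(\<forall>i\<^sub>0\<in>{1..<s}. \<forall>\<beta>\<^sub>0\<in>{1..n i\<^sub>0}.
           X i\<^sub>0 \<beta>\<^sub>0 =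
             right_invariant_vf G A (X i\<^sub>0 \<beta>\<^sub>0) +
             (\<Sum>k=1..s - i\<^sub>0. (1 / fact k) *\<^sub>v
               (\<Sum>i\<in>{i \<in> {1..k} \<rightarrow>\<^sub>E {1..s}. (\<Sum>j=1..k. i j) \<le> s - i\<^sub>0}.
                \<Sum>\<alpha>\<in>(\<Pi>\<^sub>E j\<in>{1..k}. {1..n (i j)}).
                \<Sum>\<beta>\<in>(\<Pi>\<^sub>E j\<in>{1..k}. {1..n (i\<^sub>0 + (\<Sum>m=1..j. i m))}).
                  (\<lambda>p. (\<Prod>j=1..k. c (i j) (i\<^sub>0 + (\<Sum>m=1..<j. i m)) (\<alpha> j) ((\<beta>(0 := \<beta>\<^sub>0)) (j - 1)) (\<beta> j)) *
                       (\<Prod>j=1..k. x (i j) (\<alpha> j) p))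
                  \<cdot>\<^sub>v right_invariant_vf G A (X (i\<^sub>0 + (\<Sum>m=1..k. i m)) (\<beta> k))))) \<and>
         (\<forall>\<beta>\<^sub>0\<in>{1..n s}. X s \<beta>\<^sub>0 = right_invariant_vf G A (X s \<beta>\<^sub>0))"
proof -
  interpret adapted_lie_group G A s V n X c
    using assms unfolding stratified_group_def
    by unfold_locales simp_all
  \<comment> \<open>In the last layer the sum over \<open>k\<close> in the expansion is empty.\<close>
  have last: "X s \<beta>\<^sub>0 = right_invariant_vf G A (X s \<beta>\<^sub>0)" if "\<beta>\<^sub>0 \<in> {1..n s}" for \<beta>\<^sub>0
    using left_invariant_eq_right_invariant_expansion[OF assms(4) _ that] strat
    by (simp add: stratification_def)
  show ?thesis
    by (intro conjI ballI last left_invariant_eq_right_invariant_expansion[OF assms(4)]) auto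
qed

end
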